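(* There is an absolute constant $C>0$ such that the following holds. Let $\epsilon\ge\epsilon'\ge 0$, $\delta\ge 0$, $\delta'>0$, and let $\mathcal D$ be a family of pairs of probability distributions on $\mathbb{R}^d$ that is $(\epsilon,\delta)$-robustly feasible and has finite covering number $\mathcal N_{W_\infty,\mathrm{TV}}(\mathcal D,\epsilon',\delta')$. Then $\mathcal D$ is $(\epsilon-\epsilon',\delta+2\delta')$-robustly learnable with $n$ samples whenever $$n\ge C\,\frac{\delta+\delta'}{\delta'^2}\,\log\bigl(\mathcal N_{W_\infty,\mathrm{TV}}(\mathcal D,\epsilon',\delta')\bigr).$$
   Context: Fix a norm $\|\cdot\|$ on $\mathbb{R}^d$ and let $B(\epsilon)=\{z\in\mathbb{R}^d:\|z\|\le\epsilon\}$. For $f:\mathbb{R}^d\to\{0,1\}$ and $(x,i)\in\mathbb{R}^d\times\{0,1\}$, the $\epsilon$-robust zero-one loss is $\ell_\epsilon(f,x,i)=\mathbf 1\{\exists z\in B(\epsilon): f(x+z)\ne i\}$. A classifier $f:\mathbb{R}^d\to\{0,1\}$ is $(\epsilon,\delta)$-robust for a pair of distributions $D=(D_0,D_1)$ if $\mathbb{E}_{X\sim D_i}[\ell_\epsilon(f,X,i)]\le\delta$ for each $i\in\{0,1\}$. A classification algorithm receives $n$ i.i.d. samples from $D_0$ and $n$ i.i.d. samples from $D_1$ and outputs a classifier. $\mathcal D$ is $(\epsilon,\delta)$-robustly learnable with $n$ samples if there is a classification algorithm such that for every $D\in\mathcal D$, with probability at least $2/3$ over the samples, it outputs a classifier that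 is $(\epsilon,\delta)$-robust for $D$ (no computational restriction). $\mathcal D$ is $(\epsilon,\delta)$-robustly feasible if every $D\in\mathcal D$ admits an $(\epsilon,\delta)$-robust classifier. Measurability questions are ignored. $\mathrm{TV}$ is the total variation distance $\mathrm{TV}(P,Q)=\sup_A|P(A)-Q(A)|$. $W_\infty(P,Q)$ is the infimum of $\sup_{(x,x')\in\mathrm{supp}(\mu)}\|x-x'\|$ over all measures $\mu$ on $\mathbb{R}^d\times\mathbb{R}^d$ with marginals $P$ (over $x$) and $Q$ (over $x'$). Both are extended to pairs by $\mathrm{dist}((P,P'),(Q,Q'))=\max(\mathrm{dist}(P,Q),\mathrm{dist}(P',Q'))$. For a pair $x$ of distributions, let $$U_{\epsilon',\delta'}(x)=\{y:\ \exists z \text{ such that } \mathrm{TV}(x,z)\le\delta' \text{ and } W_\infty(z,y)\le\epsilon'\},$$ where $y,z$ range over pairs of probability distributions on $\mathbb{R}^d$. The covering number is $$\mathcal N_{W_\infty,\mathrm{TV}}(\mathcal D,\epsilon',\delta')=\inf\Bigl\{|X|:\ X\subset\mathcal D,\ \mathcal D\subset\bigcup_{x\in X}U_{\epsilon',\delta'}(x)\Bigr\}.$$ *)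

theory Defs
  imports "HOL-Probability.Probability" "HOL-Library.Z2"
begin

text \<open>
  The dimension has to be a bound variable, since the constant in the theorem must not depend on
  it. Hence $R^d$ is the library's \<^const>\<open>Euclidean_space\<close>: the real sequences that vanish from
  index \<open>d\<close> on, with the usual topology. Functions on $R^d$ are total HOL functions whose values
  outside this carrier play no role.
\<close>

abbreviation Rd :: "nat \<Rightarrow> (nat \<Rightarrow> real) set" where
  "Rd d \<equiv> topspace (Euclidean_space d)"

definition borel_Rd :: "nat \<Rightarrow> (nat \<Rightarrow> real) measure" where
  "borel_Rd d = sigma (Rd d) {U. openin (Euclidean_space d) U}"

definition is_norm :: "nat \<Rightarrow> ((nat \<Rightarrow> real) \<Rightarrow> real) \<Rightarrow> bool" where
  "is_norm d N \<longleftrightarrow>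
     (\<forall>x\<in>Rd d. 0 \<le> N x \<and> (N x = 0 \<longleftrightarrow> x = (\<lambda>k. 0))) \<and>
     (\<forall>c. \<forall>x\<in>Rd d. N (\<lambda>k. c * x k) = \<bar>c\<bar> * N x) \<and>
     (\<forall>x\<in>Rd d. \<forall>y\<in>Rd d. N (\<lambda>k. x k + y k) \<le> N x + N y)"

definition norm_ball :: "nat \<Rightarrow> ((nat \<Rightarrow> real) \<Rightarrow> real) \<Rightarrow> real \<Rightarrow> (nat \<Rightarrow> real) set" where
  "norm_ball d N \<epsilon> = {z \<in> Rd d. N z \<le> \<epsilon>}"

definition prob_dists :: "nat \<Rightarrow> (nat \<Rightarrow> real) measure set" where
  "prob_dists d = {P. prob_space P \<and> sets P = sets (borel_Rd d)}"

type_synonym dist_pair = "(nat \<Rightarrow> real) measure \<times> (nat \<Rightarrow> real) measure"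

definition prob_dist_pairs :: "nat \<Rightarrow> dist_pair set" where
  "prob_dist_pairs d = prob_dists d \<times> prob_dists d"

text \<open>
  Classifiers are arbitrary functions and learning algorithms are arbitrary maps from samples to
  classifiers, so neither the robust loss nor the success event of an algorithm need be measurable.
  Expectations of losses are therefore upper expectations and success probabilities are inner
  probabilities. By the two lemmas below, these are the ordinary expectation and the ordinary
  probability in the measurable case. (The unadorned \<^const>\<open>nn_integral\<close> and \<^const>\<open>measure\<close> would not
  do: on non-measurable arguments they are a lower integral and \<open>0\<close>, respectively.)
\<close>

definition upper_expectation :: "'a measure \<Rightarrow> ('a \<Rightarrow> real) \<Rightarrow> ennreal" where
  "upper_expectation M u =
     (INF g\<in>{g \<in> borel_measurable M. \<forall>x\<in>space M. ennreal (u x) \<le> g x}. \<integral>\<^sup>+ x. g x \<partial>M)"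

definition inner_prob :: "'a measure \<Rightarrow> 'a set \<Rightarrow> real" where
  "inner_prob M S = (SUP E\<in>{E \<in> sets M. E \<subseteq> S}. measure M E)"

lemma upper_expectation_eq_nn_integral:
  assumes "u \<in> borel_measurable M"
  shows "upper_expectation M u = (\<integral>\<^sup>+ x. ennreal (u x) \<partial>M)"
  unfolding upper_expectation_def
proof (rule antisym)
  show "(INF g\<in>{g \<in> borel_measurable M. \<forall>x\<in>space M. ennreal (u x) \<le> g x}. \<integral>\<^sup>+ x. g x \<partial>M)
      \<le> (\<integral>\<^sup>+ x. ennreal (u x) \<partial>M)"
    by (rule INF_lower) (use assms in auto)
  show "(\<integral>\<^sup>+ x. ennreal (u x) \<partial>M)
      \<le> (INF g\<in>{g \<in> borel_measurable M. \<forall>x\<in>space M. ennreal (u x) \<le> g x}. \<integral>\<^sup>+ x. g x \<partial>M)"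
    by (rule INF_greatest) (auto intro: nn_integral_mono)
qed

lemma inner_prob_eq_measure:
  assumes "prob_space M" "S \<in> sets M"
  shows "inner_prob M S = measure M S"
proof -
  interpret prob_space M by fact
  show ?thesis
    unfolding inner_prob_def
  proof (rule antisym)
    show "(SUP E\<in>{E \<in> sets M. E \<subseteq> S}. measure M E) \<le> measure M S"
      by (rule cSUP_least) (use assms in \<open>auto intro: finite_measure_mono\<close>)
    show "measure M S \<le> (SUP E\<in>{E \<in> sets M. E \<subseteq> S}. measure M E)"
      by (rule cSUP_upper) (use assms in \<open>auto intro!: bdd_aboveI2[where M = 1]\<close>)
  qed
qed

definition robust_loss ::
  "nat \<Rightarrow> ((nat \<Rightarrow> real) \<Rightarrow> real) \<Rightarrow> real \<Rightarrow> ((nat \<Rightarrow> real) \<Rightarrow> bit) \<Rightarrow> (nat \<Rightarrow> real) \<Rightarrow> bit \<Rightarrow> real"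
where
  "robust_loss d N \<epsilon> f x i = of_bool (\<exists>z\<in>norm_ball d N \<epsilon>. f (\<lambda>k. x k + z k) \<noteq> i)"

definition robust_classifier ::
  "nat \<Rightarrow> ((nat \<Rightarrow> real) \<Rightarrow> real) \<Rightarrow> real \<Rightarrow> real \<Rightarrow> dist_pair \<Rightarrow> ((nat \<Rightarrow> real) \<Rightarrow> bit) \<Rightarrow> bool"
where
  "robust_classifier d N \<epsilon> \<delta> D f \<longleftrightarrow>
     upper_expectation (fst D) (\<lambda>x. robust_loss d N \<epsilon> f x 0) \<le> ennreal \<delta> \<and>
     upper_expectation (snd D) (\<lambda>x. robust_loss d N \<epsilon> f x 1) \<le> ennreal \<delta>"

definition robustly_feasible ::
  "nat \<Rightarrow> ((nat \<Rightarrow> real) \<Rightarrow> real) \<Rightarrow> real \<Rightarrow> real \<Rightarrow> dist_pair set \<Rightarrow> bool"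
where
  "robustly_feasible d N \<epsilon> \<delta> \<D> \<longleftrightarrow> (\<forall>D\<in>\<D>. \<exists>f. robust_classifier d N \<epsilon> \<delta> D f)"

definition sample_space :: "nat \<Rightarrow> dist_pair \<Rightarrow> ((nat \<Rightarrow> nat \<Rightarrow> real) \<times> (nat \<Rightarrow> nat \<Rightarrow> real)) measure" where
  "sample_space n D = PiM {..<n} (\<lambda>_. fst D) \<Otimes>\<^sub>M PiM {..<n} (\<lambda>_. snd D)"

definition robustly_learnable ::
  "nat \<Rightarrow> ((nat \<Rightarrow> real) \<Rightarrow> real) \<Rightarrow> real \<Rightarrow> real \<Rightarrow> nat \<Rightarrow> dist_pair set \<Rightarrow> bool"
where
  "robustly_learnable d N \<epsilon> \<delta> n \<D> \<longleftrightarrow>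
     (\<exists>alg :: (nat \<Rightarrow> nat \<Rightarrow> real) \<Rightarrow> (nat \<Rightarrow> nat \<Rightarrow> real) \<Rightarrow> (nat \<Rightarrow> real) \<Rightarrow> bit.
        \<forall>D\<in>\<D>. inner_prob (sample_space n D)
                 {(s, t) \<in> space (sample_space n D). robust_classifier d N \<epsilon> \<delta> D (alg s t)} \<ge> 2 / 3)"

definition TV :: "nat \<Rightarrow> (nat \<Rightarrow> real) measure \<Rightarrow> (nat \<Rightarrow> real) measure \<Rightarrow> real" where
  "TV d P Q = (SUP A\<in>sets (borel_Rd d). \<bar>measure P A - measure Q A\<bar>)"

definition couplings ::
  "nat \<Rightarrow> (nat \<Rightarrow> real) measure \<Rightarrow> (nat \<Rightarrow> real) measure \<Rightarrow> ((nat \<Rightarrow> real) \<times> (nat \<Rightarrow> real)) measure set"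
where
  "couplings d P Q =
     {\<mu>. sets \<mu> = sets (borel_Rd d \<Otimes>\<^sub>M borel_Rd d) \<and>
         distr \<mu> (borel_Rd d) fst = P \<and> distr \<mu> (borel_Rd d) snd = Q}"

definition measure_support :: "'a topology \<Rightarrow> 'a measure \<Rightarrow> 'a set" where
  "measure_support T \<mu> = {p \<in> topspace T. \<forall>U. openin T U \<and> p \<in> U \<longrightarrow> emeasure \<mu> U > 0}"

definition W_inf ::
  "nat \<Rightarrow> ((nat \<Rightarrow> real) \<Rightarrow> real) \<Rightarrow> (nat \<Rightarrow> real) measure \<Rightarrow> (nat \<Rightarrow> real) measure \<Rightarrow> ennreal"
where
  "W_inf d N P Q =
     (INF \<mu>\<in>couplings d P Q.
        SUP (x, x')\<in>measure_support (prod_topology (Euclidean_space d) (Euclidean_space d)) \<mu>.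
          ennreal (N (\<lambda>k. x k - x' k)))"

definition pair_dist :: "('m \<Rightarrow> 'm \<Rightarrow> 'r::linorder) \<Rightarrow> 'm \<times> 'm \<Rightarrow> 'm \<times> 'm \<Rightarrow> 'r" where
  "pair_dist dst p q = max (dst (fst p) (fst q)) (dst (snd p) (snd q))"

definition nbhd ::
  "nat \<Rightarrow> ((nat \<Rightarrow> real) \<Rightarrow> real) \<Rightarrow> real \<Rightarrow> real \<Rightarrow> dist_pair \<Rightarrow> dist_pair set"
where
  "nbhd d N \<epsilon>' \<delta>' x =
     {y \<in> prob_dist_pairs d. \<exists>z\<in>prob_dist_pairs d.
        pair_dist (TV d) x z \<le> \<delta>' \<and> pair_dist (W_inf d N) z y \<le> ennreal \<epsilon>'}"

definition covering_number ::
  "nat \<Rightarrow> ((nat \<Rightarrow> real) \<Rightarrow> real) \<Rightarrow> dist_pair set \<Rightarrow> real \<Rightarrow> real \<Rightarrow> enat"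
where
  "covering_number d N \<D> \<epsilon>' \<delta>' =
     (INF X\<in>{X. X \<subseteq> \<D> \<and> \<D> \<subseteq> (\<Union>x\<in>X. nbhd d N \<epsilon>' \<delta>' x)}.
        if finite X then enat (card X) else \<infinity>)"

end

theory Submission
  imports Defs
begin

text \<open>
  A robust classifier for a cover element \<open>x\<close> is correct, in the robust sense, on a set of measure
  at least \<open>1 - \<delta>\<close> for each label; inner regularity replaces these sets by compact cores \<open>K\<close> and
  \<open>L\<close> at a small cost \<open>\<eta>\<close>. Distinct labels force the cores to be more than \<open>2\<epsilon>\<close> apart, and by
  compactness there is a gap \<open>2r\<close> beyond that. The gap pays both for the fact that the infimum defining
  \<open>W\<^sub>\<infinity>\<close> need not be known to be attained and for a classifier (\<open>0\<close> near \<open>K\<close>, \<open>1\<close> elsewhere)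
  that is \<open>(\<epsilon> - \<epsilon>')\<close>-robust on the \<open>(\<epsilon>' + r)\<close>-thickenings of the cores; every distribution in the
  neighbourhood of \<open>x\<close> gives these open sets measure at least \<open>1 - \<delta> - \<delta>' - \<eta>\<close>.

  The learner selects the cover element whose thickened cores miss the fewest sample points. Multiplicative
  Chernoff bounds at the threshold \<open>\<delta> + 3\<delta>'/2\<close>, between the rate \<open>\<delta> + 5\<delta>'/4\<close> of a good element (for
  \<open>\<eta> = \<delta>'/4\<close>) and the target \<open>\<delta> + 2\<delta>'\<close>, and a union bound over the cover show that it succeeds with
  probability at least \<open>2/3\<close>.
\<close>

subsection \<open>Borel sets and norms on $R^d$\<close>

lemma openin_Euclidean_space_iff:
  "openin (Euclidean_space d) U \<longleftrightarrow> (\<exists>T. open T \<and> U = T \<inter> Rd d)"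
  unfolding Euclidean_space_def openin_subtopology euclidean_product_topology open_openin[symmetric]
  by (simp add: topspace_Euclidean_space)

lemma space_borel_Rd [simp]: "space (borel_Rd d) = Rd d"
  by (simp add: borel_Rd_def space_measure_of_conv)

lemma closed_Rd: "closed (Rd d)"
  using closedin_Euclidean_space_iff by blast

text \<open>Open sets of \<open>Euclidean_space d\<close> are traces of open sets of the type
  \<open>nat \<Rightarrow> real\<close>, and generating a sigma-algebra commutes with traces. This
  links \<open>borel_Rd\<close> to results about \<open>borel\<close>.\<close>

lemma sets_borel_Rd: "sets (borel_Rd d) = sets (restrict_space borel (Rd d))"
proof -
  have "{U. openin (Euclidean_space d) U} = (\<inter>) (Rd d) ` {T. open T}"
    by (auto simp: openin_Euclidean_space_iff)
  moreover have "{U. openin (Euclidean_space d) U} \<subseteq> Pow (Rd d)"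
    by (auto dest: openin_subset)
  moreover have "Rd d \<in> sigma_sets UNIV {T. open T}"
    using borel_closed[OF closed_Rd] by (simp add: borel_def)
  ultimately show ?thesis
    unfolding borel_Rd_def sets_restrict_space borel_def
    by (simp add: sets_measure_of sigma_sets_Int[where sp=UNIV])
qed

lemma borel_Rd_borelD: "A \<in> sets (borel_Rd d) \<Longrightarrow> A \<in> sets borel"
  using closed_Rd[of d] by (auto simp: sets_borel_Rd sets_restrict_space)

lemma borel_Rd_Int: "A \<in> sets borel \<Longrightarrow> A \<inter> Rd d \<in> sets (borel_Rd d)"
  by (auto simp: sets_borel_Rd sets_restrict_space)

lemma measurable_id_borel_Rd: "(\<lambda>x. x) \<in> borel_Rd d \<rightarrow>\<^sub>M borel"
  by (rule measurableI) (auto dest: borel_Rd_Int)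

text \<open>Second countability makes the Borel sets of a product the product of the Borel
  sigma-algebras (\<open>borel_prod\<close>), so the inclusion of pairs into the ambient type is
  Borel measurable.\<close>

lemma pair_borel_Rd_open:
  fixes T :: "((nat \<Rightarrow> real) \<times> (nat \<Rightarrow> real)) set"
  assumes "open T"
  shows "T \<inter> Rd d \<times> Rd d \<in> sets (borel_Rd d \<Otimes>\<^sub>M borel_Rd d)"
proof -
  have "(\<lambda>p. (fst p, snd p)) \<in> borel_Rd d \<Otimes>\<^sub>M borel_Rd d \<rightarrow>\<^sub>M borel \<Otimes>\<^sub>M borel"
    using measurable_id_borel_Rd[of d]
    by (intro measurable_Pair) (auto intro: measurable_compose[OF measurable_fst] measurable_compose[OF measurable_snd])
  then have "(\<lambda>p. p) \<in> borel_Rd d \<Otimes>\<^sub>M borel_Rd d \<rightarrow>\<^sub>M borel"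
    by (simp add: borel_prod)
  from measurable_sets[OF this, of T] assms show ?thesis
    by (simp add: space_pair_measure)
qed

text \<open>Every point outside the support has a null neighbourhood from a fixed countable basis,
  and countably many null sets have a null union. Hence the supremum over the support in
  \<open>W_inf\<close> is a bound that holds almost surely.\<close>

lemma AE_measure_support:
  fixes \<mu> :: "((nat \<Rightarrow> real) \<times> (nat \<Rightarrow> real)) measure"
  assumes "sets \<mu> = sets (borel_Rd d \<Otimes>\<^sub>M borel_Rd d)"
  shows "AE p in \<mu>. p \<in> measure_support (prod_topology (Euclidean_space d) (Euclidean_space d)) \<mu>"
proof -
  let ?X = "prod_topology (Euclidean_space d) (Euclidean_space d)"
  have openin_X: "openin ?X U \<longleftrightarrow> (\<exists>T. open T \<and> U = T \<inter> Rd d \<times> Rd d)" for U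
    unfolding Euclidean_space_def euclidean_product_topology subtopology_Times[symmetric]
      prod_topology_euclidean[symmetric] openin_subtopology open_openin[symmetric]
    by (simp add: topspace_Euclidean_space)
  have space: "space \<mu> = Rd d \<times> Rd d"
    using sets_eq_imp_space_eq[OF assms] by (simp add: space_pair_measure)
  obtain B :: "((nat \<Rightarrow> real) \<times> (nat \<Rightarrow> real)) set set"
    where B: "countable B" "topological_basis B"
    using ex_countable_basis by blast
  define B0 where "B0 = {b \<in> B. emeasure \<mu> (b \<inter> Rd d \<times> Rd d) = 0}"
  have meas: "open T \<Longrightarrow> T \<inter> Rd d \<times> Rd d \<in> sets \<mu>" for T
    using pair_borel_Rd_open assms by simp
  have "AE p in \<mu>. p \<notin> b" if "b \<in> B0" for b
  proof (rule AE_I[where N = "b \<inter> Rd d \<times> Rd d"])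
    show "b \<inter> Rd d \<times> Rd d \<in> sets \<mu>"
      using that B(2) by (auto simp: B0_def intro: meas topological_basis_open)
  qed (use that space in \<open>auto simp: B0_def\<close>)
  moreover have "countable B0"
    using B(1) unfolding B0_def by (rule countable_subset[rotated]) auto
  ultimately have "AE p in \<mu>. \<forall>b\<in>B0. p \<notin> b"
    by (simp add: AE_ball_countable)
  moreover have "p \<in> measure_support ?X \<mu>" if p: "p \<in> space \<mu>" and np: "\<forall>b\<in>B0. p \<notin> b" for p
  proof (rule ccontr)
    assume "p \<notin> measure_support ?X \<mu>"
    then obtain U where "openin ?X U" "p \<in> U" "emeasure \<mu> U = 0"
      using p space by (auto simp: measure_support_def not_less)
    then obtain T where T: "open T" "p \<in> T" "emeasure \<mu> (T \<inter> Rd d \<times> Rd d) = 0"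
      unfolding openin_X by auto
    obtain b where b: "b \<in> B" "p \<in> b" "b \<subseteq> T"
      using topological_basisE[OF B(2) T(1,2)] by blast
    have "emeasure \<mu> (b \<inter> Rd d \<times> Rd d) \<le> emeasure \<mu> (T \<inter> Rd d \<times> Rd d)"
      using b by (intro emeasure_mono meas T) auto
    with T b have "b \<in> B0"
      by (simp add: B0_def)
    with np b show False
      by blast
  qed
  ultimately show ?thesis
    using AE_space[of \<mu>] by (auto elim!: eventually_elim2)
qed

text \<open>Borel measures on the Polish space \<open>nat \<Rightarrow> real\<close> are inner
  regular, so \<open>P\<close> is pushed forward along the inclusion. A compact set found inside
  \<open>A\<close> lies in \<open>Rd d\<close> and has the same mass under \<open>P\<close>.\<close>

lemma prob_dists_inner_regular:
  assumes P: "P \<in> prob_dists d" and A: "A \<in> sets (borel_Rd d)" and \<eta>: "\<eta> > 0"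
  obtains K where "K \<subseteq> A" "compact K" "K \<in> sets (borel_Rd d)" "measure P A - \<eta> < measure P K"
proof -
  interpret P: prob_space P
    using P by (simp add: prob_dists_def)
  have sets_P: "sets P = sets (borel_Rd d)"
    using P by (simp add: prob_dists_def)
  then have space_P: "space P = Rd d"
    by (simp add: sets_eq_imp_space_eq[OF sets_P])
  have id: "(\<lambda>x. x) \<in> P \<rightarrow>\<^sub>M borel"
    using measurable_id_borel_Rd measurable_cong_sets[OF sets_P refl] by blast
  let ?M = "distr P borel (\<lambda>x. x)"
  interpret M: prob_space ?M
    by (rule P.prob_space_distr[OF id])
  have em: "emeasure ?M B = emeasure P B" if "B \<in> sets (borel_Rd d)" for B
    using emeasure_distr[OF id borel_Rd_borelD[OF that]] sets.sets_into_space[OF that]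
    by (simp add: space_P Int_absorb2)
  have "emeasure P A = (SUP K\<in>{K. K \<subseteq> A \<and> compact K}. emeasure ?M K)"
    using inner_regular[of ?M A] A by (simp add: em borel_Rd_borelD)
  show ?thesis
  \<comment> \<open>\<open>ennreal\<close> truncates negative numbers to 0, so the strict comparison
    is available only for a nonnegative difference; for a negative one the empty set
    suffices.\<close>
  proof (cases "measure P A - \<eta> < 0")
    case True
    then show ?thesis
      by (intro that[of "{}"]) auto
  next
    case False
    then have "ennreal (measure P A - \<eta>) < emeasure P A"
      using \<eta> by (simp add: P.emeasure_eq_measure ennreal_less_iff)
    also have "emeasure P A = (SUP K\<in>{K. K \<subseteq> A \<and> compact K}. emeasure ?M K)"
      by fact
    finally obtain K where K: "K \<subseteq> A" "compact K" "ennreal (measure P A - \<eta>) < emeasure ?M K"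
      by (auto simp: less_SUP_iff)
    have "K = K \<inter> Rd d"
      using K(1) sets.sets_into_space[OF A] by auto
    then have K_sets: "K \<in> sets (borel_Rd d)"
      using borel_Rd_Int[of K d] K(2) by (metis borel_compact)
    with K False have "measure P A - \<eta> < measure P K"
      by (simp add: em P.emeasure_eq_measure ennreal_less_iff)
    with K K_sets show ?thesis
      by (intro that)
  qed
qed

section \<open>Norm inequalities and continuity of the norm\<close>

lemma Rd_subspace: "x \<in> Rd d \<Longrightarrow> y \<in> Rd d \<Longrightarrow> (\<lambda>k. x k - y k) \<in> Rd d"
  "x \<in> Rd d \<Longrightarrow> y \<in> Rd d \<Longrightarrow> (\<lambda>k. x k + y k) \<in> Rd d"
  "x \<in> Rd d \<Longrightarrow> (\<lambda>k. c * x k) \<in> Rd d"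
  by (auto simp: topspace_Euclidean_space)

lemma is_norm_scale: "is_norm d N \<Longrightarrow> x \<in> Rd d \<Longrightarrow> N (\<lambda>k. c * x k) = \<bar>c\<bar> * N x"
  by (auto simp: is_norm_def)

lemma is_norm_triangle:
  "is_norm d N \<Longrightarrow> x \<in> Rd d \<Longrightarrow> y \<in> Rd d \<Longrightarrow> N (\<lambda>k. x k + y k) \<le> N x + N y"
  by (auto simp: is_norm_def)

lemma is_norm_triangle_diff:
  assumes N: "is_norm d N" and "x \<in> Rd d" "y \<in> Rd d" "z \<in> Rd d"
  shows "N (\<lambda>k. x k - z k) \<le> N (\<lambda>k. x k - y k) + N (\<lambda>k. y k - z k)"
  using is_norm_triangle[OF N Rd_subspace(1)[OF assms(2,3)] Rd_subspace(1)[OF assms(3,4)]] by simp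

lemma is_norm_minus_commute:
  assumes "is_norm d N" "x \<in> Rd d" "y \<in> Rd d"
  shows "N (\<lambda>k. x k - y k) = N (\<lambda>k. y k - x k)"
  using is_norm_scale[OF assms(1) Rd_subspace(1)[OF assms(3,2)], of "-1"] by simp

text \<open>Expansion in the standard basis, one coordinate at a time; \<open>m \<le> d\<close>
  keeps the basis vectors inside \<open>Rd d\<close>, where the norm axioms hold. The bound compares
  an arbitrary norm with the coordinatewise topology.\<close>

lemma is_norm_le_coordinates:
  assumes N: "is_norm d N" and x: "x \<in> Rd d"
  shows "N x \<le> (\<Sum>i<d. \<bar>x i\<bar> * N (\<lambda>k. of_bool (k = i)))"
proof -
  have "N (\<lambda>k. if k < m then x k else 0) \<le> (\<Sum>i<m. \<bar>x i\<bar> * N (\<lambda>k. of_bool (k = i)))"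
    if "m \<le> d" for m
    using that
  proof (induction m)
    case 0
    have "N (\<lambda>k. 0) = 0"
      using N by (auto simp: is_norm_def topspace_Euclidean_space)
    then show ?case by simp
  next
    case (Suc m)
    let ?e = "\<lambda>k. of_bool (k = m) :: real" and ?y = "\<lambda>k. if k < m then x k else 0"
    have e: "?e \<in> Rd d" and y: "?y \<in> Rd d"
      using Suc.prems x by (auto simp: topspace_Euclidean_space)
    have "(\<lambda>k. if k < Suc m then x k else 0) = (\<lambda>k. ?y k + x m * ?e k)"
      by (auto simp: fun_eq_iff less_Suc_eq)
    then have "N (\<lambda>k. if k < Suc m then x k else 0) \<le> N ?y + N (\<lambda>k. x m * ?e k)"
      using is_norm_triangle[OF N y Rd_subspace(3)[OF e, of "x m"]] by simp
    also have "N (\<lambda>k. x m * ?e k) = \<bar>x m\<bar> * N ?e"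
      by (rule is_norm_scale[OF N e])
    finally show ?case
      using Suc by simp
  qed
  from this[of d] have "N (\<lambda>k. if k < d then x k else 0) \<le> (\<Sum>i<d. \<bar>x i\<bar> * N (\<lambda>k. of_bool (k = i)))"
    by simp
  moreover have "(\<lambda>k. if k < d then x k else 0) = x"
    using x by (auto simp: topspace_Euclidean_space fun_eq_iff)
  ultimately show ?thesis
    by simp
qed

text \<open>By the triangle inequality the value changes by at most the norms of the two
  displacements. The coordinate bound for these is the function \<open>g\<close>, which tends to 0
  in the product topology.\<close>

lemma continuous_on_norm_diff:
  assumes N: "is_norm d N"
  shows "continuous_on (Rd d \<times> Rd d) (\<lambda>(u, v). N (\<lambda>k. u k - v k))"
  unfolding continuous_on_def
proof
  fix p assume p: "p \<in> Rd d \<times> Rd d"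
  let ?F = "at p within Rd d \<times> Rd d"
  define S where "S x = (\<Sum>i<d. \<bar>x i\<bar> * N (\<lambda>k. of_bool (k = i)))" for x :: "nat \<Rightarrow> real"
  define f where "f = (\<lambda>q. N (\<lambda>k. fst q k - snd q k))"
  define g where "g q = S (\<lambda>k. fst q k - fst p k) + S (\<lambda>k. snd q k - snd p k)" for q
  have coord: "((\<lambda>q. fst q i) \<longlongrightarrow> fst p i) ?F" "((\<lambda>q. snd q i) \<longlongrightarrow> snd p i) ?F" for i
  proof -
    have "continuous_on (Rd d \<times> Rd d) (\<lambda>q. fst q i)" "continuous_on (Rd d \<times> Rd d) (\<lambda>q. snd q i)"
      by (rule continuous_on_product_then_coordinatewise,
          rule continuous_on_fst continuous_on_snd, rule continuous_on_id)+
    with p show "((\<lambda>q. fst q i) \<longlongrightarrow> fst p i) ?F" "((\<lambda>q. snd q i) \<longlongrightarrow> snd p i) ?F"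
      unfolding continuous_on_def by blast+
  qed
  have "(g \<longlongrightarrow> g p) ?F"
    unfolding g_def S_def by (intro tendsto_intros coord)
  then have g0: "(g \<longlongrightarrow> 0) ?F"
    by (simp add: g_def S_def)
  have le: "norm (f q - f p) \<le> g q" if q: "q \<in> Rd d \<times> Rd d" for q
  proof -
    obtain u v u' v' where pq: "p = (u, v)" "q = (u', v')"
      by (metis surj_pair)
    with p q have in_Rd: "u \<in> Rd d" "v \<in> Rd d" "u' \<in> Rd d" "v' \<in> Rd d"
      by auto
    note tri = is_norm_triangle_diff[OF N]
    have "N (\<lambda>k. u' k - u k) \<le> S (\<lambda>k. u' k - u k)" "N (\<lambda>k. v' k - v k) \<le> S (\<lambda>k. v' k - v k)"
      unfolding S_def using in_Rd by (intro is_norm_le_coordinates[OF N] Rd_subspace; simp)+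
    then show ?thesis
      using tri[OF in_Rd(3,1,4)] tri[OF in_Rd(1,2,4)] tri[OF in_Rd(1,3,2)] tri[OF in_Rd(3,4,2)]
        is_norm_minus_commute[OF N in_Rd(1,3)] is_norm_minus_commute[OF N in_Rd(2,4)]
      unfolding pq f_def g_def fst_conv snd_conv real_norm_def by linarith
  qed
  have "\<forall>\<^sub>F q in ?F. norm (f q - f p) \<le> g q"
    unfolding eventually_at_topological using le by (blast intro: open_UNIV)
  then have "((\<lambda>q. f q - f p) \<longlongrightarrow> 0) ?F"
    using g0 by (rule Lim_null_comparison)
  then show "((\<lambda>(u, v). N (\<lambda>k. u k - v k)) \<longlongrightarrow> (case p of (u, v) \<Rightarrow> N (\<lambda>k. u k - v k))) ?F"
    unfolding f_def by (simp add: LIM_zero_iff case_prod_unfold)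
qed

section \<open>Thickenings and the transfer of mass under TV and W_inf\<close>

definition thickening :: "nat \<Rightarrow> ((nat \<Rightarrow> real) \<Rightarrow> real) \<Rightarrow> real \<Rightarrow> (nat \<Rightarrow> real) set \<Rightarrow> (nat \<Rightarrow> real) set"
  where "thickening d N r K = {v \<in> Rd d. \<exists>u\<in>K. N (\<lambda>k. u k - v k) < r}"

text \<open>The strict inequality makes the thickening a union of open balls, one for each point of
  \<open>K\<close>, hence open even if the union is uncountable.\<close>

lemma thickening_sets:
  assumes N: "is_norm d N" and K: "K \<subseteq> Rd d"
  shows "thickening d N r K \<in> sets (borel_Rd d)"
proof -
  have "openin (Euclidean_space d) {v \<in> Rd d. N (\<lambda>k. u k - v k) < r}" if "u \<in> K" for u
  proof -
    have "continuous_on (Rd d) ((\<lambda>(u, v). N (\<lambda>k. u k - v k)) \<circ> (\<lambda>v. (u, v)))"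
      using that K by (intro continuous_on_compose continuous_intros
          continuous_on_subset[OF continuous_on_norm_diff[OF N]]) auto
    then have "openin (top_of_set (Rd d)) (Rd d \<inter> (\<lambda>v. N (\<lambda>k. u k - v k)) -` {..<r})"
      by (simp add: continuous_openin_preimage_gen o_def)
    moreover have "Rd d \<inter> (\<lambda>v. N (\<lambda>k. u k - v k)) -` {..<r} = {v \<in> Rd d. N (\<lambda>k. u k - v k) < r}"
      by auto
    ultimately show ?thesis
      unfolding openin_Euclidean_space_iff openin_open by (metis Int_commute)
  qed
  then have "openin (Euclidean_space d) (\<Union>u\<in>K. {v \<in> Rd d. N (\<lambda>k. u k - v k) < r})"
    by auto
  moreover have "(\<Union>u\<in>K. {v \<in> Rd d. N (\<lambda>k. u k - v k) < r}) = thickening d N r K"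
    by (auto simp: thickening_def)
  moreover have "{U. openin (Euclidean_space d) U} \<subseteq> Pow (Rd d)"
    by (auto dest: openin_subset)
  ultimately show ?thesis
    unfolding borel_Rd_def by (intro in_measure_of) simp_all
qed

lemma TV_measure_le:
  assumes P: "P \<in> prob_dists d" and Q: "Q \<in> prob_dists d" and A: "A \<in> sets (borel_Rd d)"
  shows "measure P A \<le> measure Q A + TV d P Q"
proof -
  interpret P: prob_space P using P by (simp add: prob_dists_def)
  interpret Q: prob_space Q using Q by (simp add: prob_dists_def)
  \<comment> \<open>\<open>TV\<close> is a supremum of reals and dominates its members only once
    they are known to be bounded.\<close>
  have "\<bar>measure P B - measure Q B\<bar> \<le> 1" for B
    using P.prob_le_1[of B] Q.prob_le_1[of B] measure_nonneg[of P B] measure_nonneg[of Q B] by linarith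
  then have "\<bar>measure P A - measure Q A\<bar> \<le> TV d P Q"
    unfolding TV_def using A by (intro cSUP_upper bdd_aboveI2[where M=1]) auto
  then show ?thesis by simp
qed

text \<open>The slack \<open>r\<close> makes the infimum strictly smaller than
  \<open>\<epsilon>' + r\<close>, so some coupling has its whole support at distance below
  \<open>\<epsilon>' + r\<close>. Under it, a first coordinate in \<open>K\<close> almost surely
  forces the second into the thickening.\<close>

lemma W_inf_thickening:
  assumes P: "P \<in> prob_dists d" and Q: "Q \<in> prob_dists d" and N: "is_norm d N"
    and W: "W_inf d N P Q \<le> ennreal \<epsilon>'" and \<epsilon>: "\<epsilon>' \<ge> 0" and r: "r > 0"
    and K: "K \<in> sets (borel_Rd d)"
  shows "measure P K \<le> measure Q (thickening d N (\<epsilon>' + r) K)"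
proof -
  interpret P: prob_space P using P by (simp add: prob_dists_def)
  interpret Q: prob_space Q using Q by (simp add: prob_dists_def)
  let ?S = "measure_support (prod_topology (Euclidean_space d) (Euclidean_space d))"
  let ?G = "thickening d N (\<epsilon>' + r) K"
  have K_sub: "K \<subseteq> Rd d"
    using sets.sets_into_space[OF K] by simp
  have G: "?G \<in> sets (borel_Rd d)"
    by (rule thickening_sets[OF N K_sub])
  have "W_inf d N P Q < ennreal (\<epsilon>' + r)"
    using W r \<epsilon> by (simp add: ennreal_lessI order.strict_trans1)
  then obtain \<mu> where \<mu>: "\<mu> \<in> couplings d P Q"
    and lt: "(SUP (x, x')\<in>?S \<mu>. ennreal (N (\<lambda>k. x k - x' k))) < ennreal (\<epsilon>' + r)"
    unfolding W_inf_def by (auto simp: INF_less_iff)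
  have sets_\<mu>: "sets \<mu> = sets (borel_Rd d \<Otimes>\<^sub>M borel_Rd d)"
    and dP: "distr \<mu> (borel_Rd d) fst = P" and dQ: "distr \<mu> (borel_Rd d) snd = Q"
    using \<mu> by (auto simp: couplings_def)
  have fst: "fst \<in> \<mu> \<rightarrow>\<^sub>M borel_Rd d" and snd: "snd \<in> \<mu> \<rightarrow>\<^sub>M borel_Rd d"
    by (simp_all add: measurable_cong_sets[OF sets_\<mu> refl])
  have close: "N (\<lambda>k. u k - v k) < \<epsilon>' + r" if "(u, v) \<in> ?S \<mu>" for u v
  proof -
    have "ennreal (N (\<lambda>k. u k - v k)) \<le> (SUP (x, x')\<in>?S \<mu>. ennreal (N (\<lambda>k. x k - x' k)))"
      using that by (intro SUP_upper2[of "(u, v)"]) auto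
    also note lt
    finally show ?thesis
      by (metis ennreal_leI not_le)
  qed
  have "emeasure P K = emeasure \<mu> (fst -` K \<inter> space \<mu>)"
    using emeasure_distr[OF fst K] by (simp add: dP)
  also have "\<dots> \<le> emeasure \<mu> (snd -` ?G \<inter> space \<mu>)"
  proof (rule emeasure_mono_AE)
    show "AE p in \<mu>. p \<in> fst -` K \<inter> space \<mu> \<longrightarrow> p \<in> snd -` ?G \<inter> space \<mu>"
      using AE_measure_support[OF sets_\<mu>]
    proof eventually_elim
      case (elim p)
      moreover from elim have "snd p \<in> Rd d"
        by (auto simp: measure_support_def)
      ultimately show ?case
        using close[of "fst p" "snd p"] by (auto simp: thickening_def)
    qed
  qed (use snd G in measurable)
  also have "\<dots> = emeasure Q ?G"
    using emeasure_distr[OF snd G] by (simp add: dQ)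
  finally show ?thesis
    by (simp add: P.emeasure_eq_measure Q.emeasure_eq_measure)
qed

subsection \<open>Selecting a hypothesis by empirical error\<close>

text \<open>For negative \<open>t = - s\<close> the claim is multiplied by \<open>exp s\<close> and
  follows from the quadratic Taylor lower bound for \<open>exp s\<close>.\<close>

lemma exp_le_quadratic:
  assumes "\<bar>t\<bar> \<le> (1::real)"
  shows "exp t \<le> 1 + t + t\<^sup>2"
proof (cases "t \<ge> 0")
  case True
  then show ?thesis using assms exp_bound by simp
next
  case False
  define s where "s = - t"
  have s: "0 \<le> s" "s \<le> 1" using False assms by (auto simp: s_def)
  have "1 \<le> (1 + s + s\<^sup>2 / 2) * (1 - s + s\<^sup>2)"
  proof -
    have "(1 + s + s\<^sup>2 / 2) * (1 - s + s\<^sup>2) = 1 + s\<^sup>2 * (1 + s + s\<^sup>2) / 2"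
      by (simp add: power2_eq_square field_simps)
    then show ?thesis using s by simp
  qed
  also have "\<dots> \<le> exp s * (1 - s + s\<^sup>2)"
    using s exp_lower_Taylor_quadratic[of s] by (intro mult_right_mono) auto
  finally have "exp (- s) \<le> 1 - s + s\<^sup>2"
    by (simp add: exp_minus field_simps)
  then show ?thesis by (simp add: s_def)
qed

lemma sum_indicator_eq_count:
  fixes n :: nat
  shows "(\<Sum>j<n. indicator A (s j)) = real (card {j. j < n \<and> s j \<in> A})"
proof -
  have "(\<Sum>j<n. indicator A (s j)) = (\<Sum>j | j < n \<and> s j \<in> A. 1 :: real)"
    by (intro sum.mono_neutral_cong_right finite_lessThan) auto
  then show ?thesis by simp
qed

text \<open>Markov's inequality for the exponential of \<open>t\<close> times the count; by
  independence its expectation is a product of \<open>n\<close> equal factors, each at most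
  \<open>exp (prob A * (t + t\<^sup>2))\<close>. Positive \<open>t\<close> gives upper tails,
  negative \<open>t\<close> lower tails.\<close>

lemma (in prob_space) chernoff_mgf_bound:
  fixes t :: real
  assumes A: "A \<in> sets M" and t: "\<bar>t\<bar> \<le> 1"
    and E: "E \<in> sets (PiM {..<n} (\<lambda>_. M))"
    and large: "\<And>s. s \<in> E \<Longrightarrow> t * real (card {j. j < n \<and> s j \<in> A}) \<ge> c"
  shows "measure (PiM {..<n} (\<lambda>_. M)) E \<le> exp (real n * prob A * (t + t\<^sup>2) - c)"
proof -
  let ?P = "PiM {..<n} (\<lambda>_. M)"
  interpret PS: prob_space ?P
    by (intro prob_space_PiM prob_space_axioms)
  interpret product_prob_space "\<lambda>_. M" "{..<n}" ..
  define f where "f x = ennreal (exp (t * indicator A x))" for x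
  have f: "f \<in> borel_measurable M"
    unfolding f_def using A by measurable
  have f_eq: "f x = ennreal (exp t) * indicator A x + indicator (space M - A) x" if "x \<in> space M" for x
    using that by (auto simp: f_def indicator_def)
  have "(\<integral>\<^sup>+x. f x \<partial>M) = (\<integral>\<^sup>+x. ennreal (exp t) * indicator A x + indicator (space M - A) x \<partial>M)"
    by (rule nn_integral_cong) (rule f_eq)
  also have "\<dots> = ennreal (exp t) * emeasure M A + emeasure M (space M - A)"
    using A by (subst nn_integral_add) (auto simp: nn_integral_cmult)
  also have "\<dots> = ennreal (exp t * prob A + (1 - prob A))"
    using A by (simp add: emeasure_eq_measure prob_compl ennreal_mult)
  also have "\<dots> \<le> ennreal (exp (prob A * (t + t\<^sup>2)))"
  proof (rule ennreal_leI)
    have "exp t * prob A + (1 - prob A) = 1 + prob A * (exp t - 1)"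
      by (simp add: algebra_simps)
    also have "\<dots> \<le> 1 + prob A * (t + t\<^sup>2)"
      using exp_le_quadratic[OF t] by (intro add_left_mono mult_left_mono) auto
    also have "\<dots> \<le> exp (prob A * (t + t\<^sup>2))"
      by (rule exp_ge_add_one_self)
    finally show "exp t * prob A + (1 - prob A) \<le> exp (prob A * (t + t\<^sup>2))" .
  qed
  finally have int_f: "(\<integral>\<^sup>+x. f x \<partial>M) \<le> ennreal (exp (prob A * (t + t\<^sup>2)))" .
  have prod_f: "(\<Prod>j<n. f (s j)) = ennreal (exp (t * real (card {j. j < n \<and> s j \<in> A})))" for s
  proof -
    have "(\<Sum>j<n. t * indicator A (s j)) = t * real (card {j. j < n \<and> s j \<in> A})"
      by (simp add: sum_indicator_eq_count sum_distrib_left[symmetric])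
    then show ?thesis
      unfolding f_def by (simp add: prod_ennreal exp_sum[symmetric])
  qed
  \<comment> \<open>The Markov step: on \<open>E\<close> the integrand
    \<open>\<Prod>j<n. f (s j)\<close> is at least \<open>exp c\<close>.\<close>
  have "ennreal (exp c) * emeasure ?P E = (\<integral>\<^sup>+s. ennreal (exp c) * indicator E s \<partial>?P)"
    using E by (subst nn_integral_cmult_indicator) auto
  also have "\<dots> \<le> (\<integral>\<^sup>+s. (\<Prod>j<n. f (s j)) \<partial>?P)"
    unfolding prod_f by (intro nn_integral_mono) (auto simp: indicator_def intro!: ennreal_leI large)
  also have "\<dots> = (\<Prod>j<n. \<integral>\<^sup>+x. f x \<partial>M)"
    using f by (intro product_nn_integral_prod) auto
  also have "\<dots> \<le> (\<Prod>j<n. ennreal (exp (prob A * (t + t\<^sup>2))))"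
    using int_f by (intro prod_mono_ennreal) auto
  also have "\<dots> = ennreal (exp (real n * prob A * (t + t\<^sup>2)))"
    by (simp add: ennreal_power exp_of_nat_mult[symmetric] mult.assoc)
  finally have "exp c * measure ?P E \<le> exp (real n * prob A * (t + t\<^sup>2))"
    by (simp add: PS.emeasure_eq_measure flip: ennreal_mult)
  then show ?thesis
    by (simp add: exp_diff field_simps)
qed

lemma count_measurable:
  fixes n :: nat
  assumes "A \<in> sets M"
  shows "(\<lambda>s. real (card {j. j < n \<and> s j \<in> A})) \<in> borel_measurable (PiM {..<n} (\<lambda>_. M))"
  unfolding sum_indicator_eq_count[symmetric]
proof (rule borel_measurable_sum)
  fix j assume "j \<in> {..<n}"
  then have "(\<lambda>s. s j) \<in> PiM {..<n} (\<lambda>_. M) \<rightarrow>\<^sub>M M"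
    by (rule measurable_component_singleton)
  then show "(\<lambda>s. indicat_real A (s j)) \<in> borel_measurable (PiM {..<n} (\<lambda>_. M))"
    by (rule measurable_compose) (use assms in simp)
qed

text \<open>The point \<open>x / (2 * p)\<close> minimizes \<open>p * t\<^sup>2 - x * t\<close>, the
  shape of both Chernoff exponents, with \<open>x\<close> the gap between rate and
  threshold.\<close>

lemma quadratic_min_value:
  fixes p x :: real
  assumes "p > 0"
  shows "x / (2 * p) * (p * (x / (2 * p)) - x) = - (x\<^sup>2 / (4 * p))"
  using assms by (simp add: power2_eq_square field_simps)

text \<open>The condition \<open>T \<le> 3 * a\<close> says exactly that the optimal
  \<open>t = (T - a) / (2 * a)\<close> is at most 1. Since \<open>t + t\<^sup>2\<close> is
  nonnegative, the true rate may be raised to \<open>a\<close>.\<close>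

lemma (in prob_space) chernoff_upper:
  assumes A: "A \<in> sets M" and a: "prob A \<le> a" "0 < a" "a < T" "T \<le> 3 * a"
  shows "measure (PiM {..<n} (\<lambda>_. M))
      {s \<in> space (PiM {..<n} (\<lambda>_. M)). real n * T < real (card {j. j < n \<and> s j \<in> A})}
    \<le> exp (- (real n * ((T - a)\<^sup>2 / (4 * a))))"
proof -
  define t where "t = (T - a) / (2 * a)"
  have t: "0 < t" "t \<le> 1" using a by (auto simp: t_def field_simps)
  note count_measurable[OF A, measurable]
  let ?E = "{s \<in> space (PiM {..<n} (\<lambda>_. M)). real n * T < real (card {j. j < n \<and> s j \<in> A})}"
  have bound: "measure (PiM {..<n} (\<lambda>_. M)) ?E \<le> exp (real n * prob A * (t + t\<^sup>2) - t * (real n * T))"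
  proof (rule chernoff_mgf_bound[OF A])
    show "?E \<in> sets (PiM {..<n} (\<lambda>_. M))"
      by measurable
    show "t * (real n * T) \<le> t * real (card {j. j < n \<and> s j \<in> A})" if "s \<in> ?E" for s
      using that t by simp
  qed (use t in simp)
  moreover have "real n * prob A * (t + t\<^sup>2) \<le> real n * a * (t + t\<^sup>2)"
    using a t by (intro mult_right_mono mult_left_mono) auto
  moreover have "real n * a * (t + t\<^sup>2) - t * (real n * T) = - (real n * ((T - a)\<^sup>2 / (4 * a)))"
  proof -
    have "real n * a * (t + t\<^sup>2) - t * (real n * T) = real n * (t * (a * t - (T - a)))"
      by (simp add: power2_eq_square algebra_simps)
    also have "t * (a * t - (T - a)) = - ((T - a)\<^sup>2 / (4 * a))"
      unfolding t_def using a by (intro quadratic_min_value) auto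
    finally show ?thesis by simp
  qed
  ultimately have "real n * prob A * (t + t\<^sup>2) - t * (real n * T) \<le> - (real n * ((T - a)\<^sup>2 / (4 * a)))"
    by linarith
  then show ?thesis
    by (intro order.trans[OF bound]) (simp only: exp_le_cancel_iff)
qed

text \<open>The moment bound is applied at \<open>- t\<close>. Since \<open>T\<close> is
  nonnegative, \<open>t\<close> is at most 1/2, so \<open>- t + t\<^sup>2\<close> is nonpositive and
  the true rate may be lowered to \<open>b\<close>.\<close>

lemma (in prob_space) chernoff_lower:
  assumes A: "A \<in> sets M" and b: "b \<le> prob A" "0 \<le> T" "T < b"
  shows "measure (PiM {..<n} (\<lambda>_. M))
      {s \<in> space (PiM {..<n} (\<lambda>_. M)). real (card {j. j < n \<and> s j \<in> A}) \<le> real n * T}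
    \<le> exp (- (real n * ((b - T)\<^sup>2 / (4 * b))))"
proof -
  define t where "t = (b - T) / (2 * b)"
  have t: "0 < t" "t \<le> 1" using b by (auto simp: t_def field_simps)
  note count_measurable[OF A, measurable]
  let ?E = "{s \<in> space (PiM {..<n} (\<lambda>_. M)). real (card {j. j < n \<and> s j \<in> A}) \<le> real n * T}"
  have bound: "measure (PiM {..<n} (\<lambda>_. M)) ?E \<le> exp (real n * prob A * (- t + (- t)\<^sup>2) - (- t) * (real n * T))"
  proof (rule chernoff_mgf_bound[OF A])
    show "?E \<in> sets (PiM {..<n} (\<lambda>_. M))"
      by measurable
    show "(- t) * (real n * T) \<le> (- t) * real (card {j. j < n \<and> s j \<in> A})" if "s \<in> ?E" for s
      using that t by simp
  qed (use t in simp)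
  moreover have "real n * prob A * (- t + (- t)\<^sup>2) \<le> real n * b * (- t + (- t)\<^sup>2)"
    using b t by (intro mult_right_mono_neg mult_left_mono) (auto simp: power2_eq_square mult_left_le)
  moreover have "real n * b * (- t + (- t)\<^sup>2) - (- t) * (real n * T) = - (real n * ((b - T)\<^sup>2 / (4 * b)))"
  proof -
    have "real n * b * (- t + (- t)\<^sup>2) - (- t) * (real n * T) = real n * (t * (b * t - (b - T)))"
      by (simp add: power2_eq_square algebra_simps)
    also have "t * (b * t - (b - T)) = - ((b - T)\<^sup>2 / (4 * b))"
      unfolding t_def using b by (intro quadratic_min_value) auto
    finally show ?thesis by simp
  qed
  ultimately have "real n * prob A * (- t + (- t)\<^sup>2) - (- t) * (real n * T) \<le> - (real n * ((b - T)\<^sup>2 / (4 * b)))"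
    by linarith
  then show ?thesis
    by (intro order.trans[OF bound]) (simp only: exp_le_cancel_iff)
qed

section \<open>The union bound for an empirical minimizer\<close>

lemma measure_pair_Times:
  assumes "prob_space M" "prob_space N" "A \<in> sets M" "B \<in> sets N"
  shows "measure (M \<Otimes>\<^sub>M N) (A \<times> B) = measure M A * measure N B"
proof -
  interpret N: prob_space N by fact
  show ?thesis
    using assms(3,4) by (simp add: measure_def N.emeasure_pair_measure_Times enn2real_mult)
qed

text \<open>Outside the bad events, \<open>x0\<close> has score at most \<open>n * T\<close>, hence
  so has every minimizer; but a candidate with a true rate above \<open>b\<close> has a count above
  \<open>n * T\<close> in that class. Each candidate contributes at most
  \<open>2 * exp (- (n * c))\<close> to the failure probability.\<close>

lemma empirical_minimizer:
  fixes P Q :: "'a measure" and A B :: "'i \<Rightarrow> 'a set" and n :: nat and a b c T :: real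
  defines "score \<equiv> \<lambda>x s t. max (card {j. j < n \<and> s j \<in> A x}) (card {j. j < n \<and> t j \<in> B x})"
  assumes P: "prob_space P" and Q: "prob_space Q" and X: "finite X"
    and A: "\<And>x. x \<in> X \<Longrightarrow> A x \<in> sets P" and B: "\<And>x. x \<in> X \<Longrightarrow> B x \<in> sets Q"
    and x0: "x0 \<in> X" "measure P (A x0) \<le> a" "measure Q (B x0) \<le> a"
    and T: "0 < a" "a < T" "T < b" "T \<le> 3 * a"
    and c: "c \<le> (T - a)\<^sup>2 / (4 * a)" "c \<le> (b - T)\<^sup>2 / (4 * b)"
    and n: "card X \<noteq> 1 \<Longrightarrow> 2 * real (card X) * exp (- (real n * c)) \<le> 1 / 3"
  obtains E where "E \<in> sets (PiM {..<n} (\<lambda>_. P) \<Otimes>\<^sub>M PiM {..<n} (\<lambda>_. Q))"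
    and "2 / 3 \<le> measure (PiM {..<n} (\<lambda>_. P) \<Otimes>\<^sub>M PiM {..<n} (\<lambda>_. Q)) E"
    and "\<forall>(s, t)\<in>E. \<forall>x\<in>X. (\<forall>x'\<in>X. score x s t \<le> score x' s t) \<longrightarrow>
           measure P (A x) \<le> b \<and> measure Q (B x) \<le> b"
proof -
  interpret P: prob_space P by fact
  interpret Q: prob_space Q by fact
  let ?MP = "PiM {..<n} (\<lambda>_. P)" and ?MQ = "PiM {..<n} (\<lambda>_. Q)"
  interpret MP: prob_space ?MP by (intro prob_space_PiM P)
  interpret MQ: prob_space ?MQ by (intro prob_space_PiM Q)
  interpret PQ: pair_prob_space ?MP ?MQ ..
  let ?M = "?MP \<Otimes>\<^sub>M ?MQ"
  show thesis
  \<comment> \<open>With one candidate the logarithm is 0 and even \<open>n = 0\<close> is allowed,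
    so concentration gives nothing; the sole candidate is \<open>x0\<close>, which is correct on
    every sample.\<close>
  proof (cases "card X = 1")
    case True
    then have "X = {x0}"
      using x0 by (metis card_1_singletonE singletonD)
    then show ?thesis
      using x0 T PQ.prob_space by (intro that[of "space ?M"]) auto
  next
    case False
    let ?e = "exp (- (real n * c))"
    define hiA where "hiA x = {s \<in> space ?MP. real n * T < real (card {j. j < n \<and> s j \<in> A x})}" for x
    define loA where "loA x = {s \<in> space ?MP. real (card {j. j < n \<and> s j \<in> A x}) \<le> real n * T}" for x
    define hiB where "hiB x = {s \<in> space ?MQ. real n * T < real (card {j. j < n \<and> s j \<in> B x})}" for x
    define loB where "loB x = {s \<in> space ?MQ. real (card {j. j < n \<and> s j \<in> B x}) \<le> real n * T}" for x
    \<comment> \<open>\<open>F x\<close> is the bad event charged to \<open>x\<close>: a count that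
      is too high in either class for \<open>x0\<close>, a count that is too low in one violating
      class for another candidate, and nothing for a candidate that meets the target.\<close>
    define F where "F x = (if x = x0 then hiA x \<times> space ?MQ \<union> space ?MP \<times> hiB x
      else if b < measure P (A x) then loA x \<times> space ?MQ
      else if b < measure Q (B x) then space ?MP \<times> loB x else {})" for x
    have sets_hilo: "hiA x \<in> sets ?MP" "loA x \<in> sets ?MP" "hiB x \<in> sets ?MQ" "loB x \<in> sets ?MQ"
      if "x \<in> X" for x
    proof -
      note count_measurable[OF A[OF that], measurable] count_measurable[OF B[OF that], measurable]
      show "hiA x \<in> sets ?MP" "loA x \<in> sets ?MP" "hiB x \<in> sets ?MQ" "loB x \<in> sets ?MQ"
        unfolding hiA_def loA_def hiB_def loB_def by measurable
    qed
    have marg: "measure ?M (S \<times> space ?MQ) = measure ?MP S" if "S \<in> sets ?MP" for S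
      using measure_pair_Times[OF MP.prob_space_axioms MQ.prob_space_axioms that sets.top]
      by (simp add: MQ.prob_space)
    have marg': "measure ?M (space ?MP \<times> S) = measure ?MQ S" if "S \<in> sets ?MQ" for S
      using measure_pair_Times[OF MP.prob_space_axioms MQ.prob_space_axioms sets.top that]
      by (simp add: MP.prob_space)
    have exp_c: "exp (- (real n * u)) \<le> ?e" if "c \<le> u" for u
      using that by (simp add: mult_left_mono)
    have hi: "measure ?MP (hiA x0) \<le> ?e" "measure ?MQ (hiB x0) \<le> ?e"
      unfolding hiA_def hiB_def
      by (rule order.trans[OF P.chernoff_upper[OF A[OF x0(1)] x0(2) T(1,2,4)] exp_c[OF c(1)]],
          rule order.trans[OF Q.chernoff_upper[OF B[OF x0(1)] x0(3) T(1,2,4)] exp_c[OF c(1)]])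
    have T0: "0 \<le> T"
      using T by simp
    have loA: "measure ?MP (loA x) \<le> ?e" if "x \<in> X" "b < measure P (A x)" for x
      unfolding loA_def
      by (rule order.trans[OF P.chernoff_lower[OF A[OF that(1)] less_imp_le[OF that(2)] T0 T(3)] exp_c[OF c(2)]])
    have loB: "measure ?MQ (loB x) \<le> ?e" if "x \<in> X" "b < measure Q (B x)" for x
      unfolding loB_def
      by (rule order.trans[OF Q.chernoff_lower[OF B[OF that(1)] less_imp_le[OF that(2)] T0 T(3)] exp_c[OF c(2)]])
    have F_sets: "F x \<in> sets ?M" if "x \<in> X" for x
      unfolding F_def using sets_hilo[OF that] by auto
    have F_le: "measure ?M (F x) \<le> 2 * ?e" if x: "x \<in> X" for x
    proof -
      have hi_le: "measure ?M (hiA x0 \<times> space ?MQ \<union> space ?MP \<times> hiB x0) \<le> ?e + ?e"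
        using sets_hilo[OF x0(1)] hi
        by (intro order.trans[OF measure_Un_le] add_mono) (auto simp: marg marg')
      have loA_le: "measure ?M (loA x \<times> space ?MQ) \<le> ?e" if "b < measure P (A x)"
        using loA[OF x that] sets_hilo[OF x] by (simp add: marg)
      have loB_le: "measure ?M (space ?MP \<times> loB x) \<le> ?e" if "b < measure Q (B x)"
        using loB[OF x that] sets_hilo[OF x] by (simp add: marg')
      show ?thesis
      proof (cases "x = x0")
        case True
        then show ?thesis using hi_le by (simp add: F_def)
      next
        case False
        then have "b < measure P (A x) \<and> F x = loA x \<times> space ?MQ \<or>
            b < measure Q (B x) \<and> F x = space ?MP \<times> loB x \<or> F x = {}"
          by (simp add: F_def)
        then have "measure ?M (F x) \<le> ?e"
          using loA_le loB_le by (elim disjE) simp_all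
        also have "\<dots> \<le> 2 * ?e"
          by simp
        finally show ?thesis .
      qed
    qed
    let ?F = "\<Union>x\<in>X. F x"
    have "measure ?M ?F \<le> (\<Sum>x\<in>X. measure ?M (F x))"
      using X F_sets by (intro PQ.finite_measure_subadditive_finite) auto
    also have "\<dots> \<le> (\<Sum>x\<in>X. 2 * ?e)"
      by (intro sum_mono F_le)
    also have "\<dots> \<le> 1 / 3"
      using n[OF False] by (simp add: mult_ac)
    finally have F_third: "measure ?M ?F \<le> 1 / 3" .
    have F_meas: "?F \<in> sets ?M"
      using X F_sets by (intro sets.finite_UN) auto
    show ?thesis
    proof (rule that[of "space ?M - ?F"])
      show "space ?M - ?F \<in> sets ?M"
        using F_meas by auto
      show "2 / 3 \<le> measure ?M (space ?M - ?F)"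
        using F_third PQ.prob_compl[OF F_meas] by simp
    next
      have accurate: "measure P (A x) \<le> b \<and> measure Q (B x) \<le> b"
        if st: "(s, t) \<in> space ?M - ?F" and x: "x \<in> X"
          and min: "\<And>x'. x' \<in> X \<Longrightarrow> score x s t \<le> score x' s t" for s t x
      proof -
        have s: "s \<in> space ?MP" and t: "t \<in> space ?MQ"
          using st by (auto simp: space_pair_measure)
        have notF: "(s, t) \<notin> F y" if "y \<in> X" for y
          using st that by blast
        have "real (score x0 s t) \<le> real n * T"
          using notF[OF x0(1)] s t by (auto simp: F_def hiA_def hiB_def score_def)
        with min[OF x0(1)] have score: "real (score x s t) \<le> real n * T"
          by linarith
        show ?thesis
        proof (cases "x = x0")
          case True
          then show ?thesis using x0 T by auto
        next
          case False
          then show ?thesis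
            using notF[OF x] s t score by (auto simp: F_def loA_def loB_def score_def split: if_splits)
        qed
      qed
      show "\<forall>(s, t)\<in>space ?M - ?F. \<forall>x\<in>X. (\<forall>x'\<in>X. score x s t \<le> score x' s t) \<longrightarrow>
          measure P (A x) \<le> b \<and> measure Q (B x) \<le> b"
      proof
        fix p assume p: "p \<in> space ?M - ?F"
        obtain s t where p_eq: "p = (s, t)"
          by fastforce
        show "case p of (s, t) \<Rightarrow> \<forall>x\<in>X. (\<forall>x'\<in>X. score x s t \<le> score x' s t) \<longrightarrow>
            measure P (A x) \<le> b \<and> measure Q (B x) \<le> b"
          unfolding p_eq prod.case
        proof (intro ballI impI)
          fix x assume x: "x \<in> X" and min: "\<forall>x'\<in>X. score x s t \<le> score x' s t"
          show "measure P (A x) \<le> b \<and> measure Q (B x) \<le> b"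
            by (rule accurate[OF p[unfolded p_eq] x bspec[OF min]])
        qed
      qed
    qed
  qed
qed

subsection \<open>Robust classifiers on neighbourhoods\<close>

text \<open>Some measurable majorant \<open>g\<close> of the loss has integral below
  \<open>\<delta> + \<eta> / 2\<close>. By Markov's inequality this bounds the set where
  \<open>g\<close> is at least 1, which contains every point of loss 1; the other
  \<open>\<eta> / 2\<close> pays for compactness.\<close>

lemma robust_core:
  assumes P: "P \<in> prob_dists d" and \<delta>: "\<delta> \<ge> 0" and \<eta>: "\<eta> > 0"
    and loss: "upper_expectation P (\<lambda>x. robust_loss d N \<epsilon> f x i) \<le> ennreal \<delta>"
  obtains K where "compact K" "K \<in> sets (borel_Rd d)" "1 - \<delta> - \<eta> \<le> measure P K"
    "\<And>v. v \<in> K \<Longrightarrow> robust_loss d N \<epsilon> f v i = 0"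
proof -
  interpret P: prob_space P
    using P by (simp add: prob_dists_def)
  have sets_P: "sets P = sets (borel_Rd d)"
    using P by (simp add: prob_dists_def)
  have "upper_expectation P (\<lambda>x. robust_loss d N \<epsilon> f x i) < ennreal (\<delta> + \<eta> / 2)"
    using loss \<delta> \<eta> by (elim order.strict_trans1) (auto intro!: ennreal_lessI)
  then obtain g where g: "g \<in> borel_measurable P"
    and loss_le: "\<And>x. x \<in> space P \<Longrightarrow> ennreal (robust_loss d N \<epsilon> f x i) \<le> g x"
    and int_g: "(\<integral>\<^sup>+ x. g x \<partial>P) < ennreal (\<delta> + \<eta> / 2)"
    unfolding upper_expectation_def by (auto simp: INF_less_iff)
  define A where "A = {x \<in> space P. 1 \<le> g x}"
  have A: "A \<in> sets P"
    unfolding A_def using g by measurable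
  have "emeasure P A = (\<integral>\<^sup>+ x. indicator A x \<partial>P)"
    using A by simp
  also have "\<dots> \<le> (\<integral>\<^sup>+ x. g x \<partial>P)"
    by (rule nn_integral_mono) (auto simp: A_def indicator_def)
  also note int_g
  finally have "measure P A < \<delta> + \<eta> / 2"
    using \<delta> \<eta> by (simp only: P.emeasure_eq_measure ennreal_less_iff[OF measure_nonneg])
  then have compl: "1 - \<delta> - \<eta> / 2 < measure P (space P - A)"
    using P.prob_compl[OF A] by simp
  have "space P - A \<in> sets (borel_Rd d)"
    using A sets_P by auto
  then obtain K where K: "K \<subseteq> space P - A" "compact K" "K \<in> sets (borel_Rd d)"
    "measure P (space P - A) - \<eta> / 2 < measure P K"
    using prob_dists_inner_regular[OF P _ half_gt_zero[OF \<eta>]] by blast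
  show ?thesis
  proof (rule that[of K])
    show "1 - \<delta> - \<eta> \<le> measure P K"
      using K(4) compl by linarith
    fix v assume "v \<in> K"
    then have "v \<in> space P" "\<not> 1 \<le> g v"
      using K(1) by (auto simp: A_def)
    then have "robust_loss d N \<epsilon> f v i \<noteq> 1"
      using loss_le[of v] by auto
    then show "robust_loss d N \<epsilon> f v i = 0"
      by (simp add: robust_loss_def of_bool_def split: if_splits)
  qed (use K in auto)
qed

text \<open>Otherwise the midpoint of \<open>u\<close> and \<open>v\<close> lies within
  \<open>\<epsilon>\<close> of both, and \<open>f\<close> would have to take both labels
  there.\<close>

lemma robust_cores_far_apart:
  assumes N: "is_norm d N" and in_Rd: "u \<in> Rd d" "v \<in> Rd d"
    and u: "robust_loss d N \<epsilon> f u 0 = 0" and v: "robust_loss d N \<epsilon> f v 1 = 0"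
  shows "2 * \<epsilon> < N (\<lambda>k. u k - v k)"
proof (rule ccontr)
  assume close: "\<not> 2 * \<epsilon> < N (\<lambda>k. u k - v k)"
  have "N (\<lambda>k. c * (u k - v k)) \<le> \<epsilon>" if "\<bar>c\<bar> = 1 / 2" for c
    using close is_norm_scale[OF N Rd_subspace(1)[OF in_Rd], of c] unfolding that by linarith
  then have ball: "(\<lambda>k. c * (u k - v k)) \<in> norm_ball d N \<epsilon>" if "\<bar>c\<bar> = 1 / 2" for c
    using that Rd_subspace(3)[OF Rd_subspace(1)[OF in_Rd]] by (simp add: norm_ball_def)
  have "f (\<lambda>k. u k + (- 1 / 2) * (u k - v k)) = 0"
    using u ball[of "- 1 / 2"] by (auto simp: robust_loss_def)
  moreover have "f (\<lambda>k. v k + (1 / 2) * (u k - v k)) = 1"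
    using v ball[of "1 / 2"] by (auto simp: robust_loss_def)
  moreover have "(\<lambda>k. u k + (- 1 / 2) * (u k - v k)) = (\<lambda>k. v k + (1 / 2) * (u k - v k))"
    by (auto simp: fun_eq_iff field_simps)
  ultimately show False by simp
qed

text \<open>The distance attains its minimum on the compact product, and \<open>r\<close> is half of
  its excess over \<open>R\<close>; if a core is empty, \<open>r = 1\<close> serves.\<close>

lemma robust_cores_gap:
  assumes N: "is_norm d N" and sub: "K \<subseteq> Rd d" "L \<subseteq> Rd d" and cpt: "compact K" "compact L"
    and far: "\<And>u v. u \<in> K \<Longrightarrow> v \<in> L \<Longrightarrow> R < N (\<lambda>k. u k - v k)"
  obtains r where "r > 0" "\<And>u v. u \<in> K \<Longrightarrow> v \<in> L \<Longrightarrow> R + 2 * r \<le> N (\<lambda>k. u k - v k)"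
proof (cases "K \<times> L = {}")
  case True
  then show ?thesis by (intro that[of 1]) auto
next
  case False
  have "continuous_on (K \<times> L) (\<lambda>(u, v). N (\<lambda>k. u k - v k))"
    using sub by (intro continuous_on_subset[OF continuous_on_norm_diff[OF N]]) auto
  then obtain p where p: "p \<in> K \<times> L"
    and min: "\<And>q. q \<in> K \<times> L \<Longrightarrow> (case p of (u, v) \<Rightarrow> N (\<lambda>k. u k - v k)) \<le> (case q of (u, v) \<Rightarrow> N (\<lambda>k. u k - v k))"
    using continuous_attains_inf[OF compact_Times[OF cpt] False] by blast
  obtain u0 v0 where p_eq: "p = (u0, v0)" by fastforce
  show ?thesis
  proof (rule that[of "(N (\<lambda>k. u0 k - v0 k) - R) / 2"])
    show "0 < (N (\<lambda>k. u0 k - v0 k) - R) / 2"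
      using far[of u0 v0] p by (simp add: p_eq)
    show "R + 2 * ((N (\<lambda>k. u0 k - v0 k) - R) / 2) \<le> N (\<lambda>k. u k - v k)" if "u \<in> K" "v \<in> L" for u v
      using min[of "(u, v)"] that by (simp add: p_eq field_simps)
  qed
qed

text \<open>The indicator of the exceptional set is a measurable majorant of the loss, so its
  integral bounds the upper expectation.\<close>

lemma robust_classifierI:
  assumes D: "D \<in> prob_dist_pairs d"
    and A: "A \<in> sets (borel_Rd d)" "measure (fst D) A \<le> b"
    and B: "B \<in> sets (borel_Rd d)" "measure (snd D) B \<le> b"
    and lossA: "\<And>v. v \<in> Rd d \<Longrightarrow> v \<notin> A \<Longrightarrow> robust_loss d N \<epsilon> f v 0 = 0"
    and lossB: "\<And>v. v \<in> Rd d \<Longrightarrow> v \<notin> B \<Longrightarrow> robust_loss d N \<epsilon> f v 1 = 0"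
  shows "robust_classifier d N \<epsilon> b D f"
proof -
  have "upper_expectation P (\<lambda>x. robust_loss d N \<epsilon> f x i) \<le> ennreal b"
    if P: "P \<in> prob_dists d" and S: "S \<in> sets (borel_Rd d)" "measure P S \<le> b"
      and loss: "\<And>v. v \<in> Rd d \<Longrightarrow> v \<notin> S \<Longrightarrow> robust_loss d N \<epsilon> f v i = 0" for P S i
  proof -
    interpret P: prob_space P
      using P by (simp add: prob_dists_def)
    have sets_P: "sets P = sets (borel_Rd d)"
      using P by (simp add: prob_dists_def)
    have "upper_expectation P (\<lambda>x. robust_loss d N \<epsilon> f x i) \<le> (\<integral>\<^sup>+ x. indicator S x \<partial>P)"
      unfolding upper_expectation_def
    proof (rule INF_lower, safe)
      show "indicator S \<in> borel_measurable P"
        using S sets_P by simp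
      fix x assume "x \<in> space P"
      then have "x \<in> Rd d"
        by (simp add: sets_eq_imp_space_eq[OF sets_P])
      then show "ennreal (robust_loss d N \<epsilon> f x i) \<le> indicator S x"
        using loss[of x] by (auto simp: indicator_def robust_loss_def)
    qed
    also have "\<dots> \<le> ennreal b"
      using S sets_P by (simp add: P.emeasure_eq_measure ennreal_leI)
    finally show ?thesis .
  qed
  with assms show ?thesis
    by (auto simp: robust_classifier_def prob_dist_pairs_def)
qed

text \<open>Passing from \<open>x\<close> to the intermediate pair \<open>z\<close> costs mass
  \<open>\<delta>'\<close>; passing from \<open>z\<close> to \<open>y\<close> costs none, because
  the set is thickened instead.\<close>

lemma nbhd_thickening:
  assumes y: "y \<in> nbhd d N \<epsilon>' \<delta>' x" and x: "x \<in> prob_dist_pairs d" and N: "is_norm d N"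
    and \<epsilon>': "\<epsilon>' \<ge> 0" and r: "r > 0"
    and K: "K \<in> sets (borel_Rd d)" and L: "L \<in> sets (borel_Rd d)"
  shows "measure (fst x) K - \<delta>' \<le> measure (fst y) (thickening d N (\<epsilon>' + r) K)"
    and "measure (snd x) L - \<delta>' \<le> measure (snd y) (thickening d N (\<epsilon>' + r) L)"
proof -
  obtain z where z: "z \<in> prob_dist_pairs d" and y': "y \<in> prob_dist_pairs d"
    and TV: "TV d (fst x) (fst z) \<le> \<delta>'" "TV d (snd x) (snd z) \<le> \<delta>'"
    and W: "W_inf d N (fst z) (fst y) \<le> ennreal \<epsilon>'" "W_inf d N (snd z) (snd y) \<le> ennreal \<epsilon>'"
    using y by (auto simp: nbhd_def pair_dist_def)
  have in_dists: "fst w \<in> prob_dists d" "snd w \<in> prob_dists d" if "w \<in> prob_dist_pairs d" for w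
    using that by (auto simp: prob_dist_pairs_def)
  show "measure (fst x) K - \<delta>' \<le> measure (fst y) (thickening d N (\<epsilon>' + r) K)"
    using TV_measure_le[OF in_dists(1)[OF x] in_dists(1)[OF z] K] TV(1)
      W_inf_thickening[OF in_dists(1)[OF z] in_dists(1)[OF y'] N W(1) \<epsilon>' r K] by linarith
  show "measure (snd x) L - \<delta>' \<le> measure (snd y) (thickening d N (\<epsilon>' + r) L)"
    using TV_measure_le[OF in_dists(2)[OF x] in_dists(2)[OF z] L] TV(2)
      W_inf_thickening[OF in_dists(2)[OF z] in_dists(2)[OF y'] N W(2) \<epsilon>' r L] by linarith
qed

text \<open>\<open>A\<close> and \<open>B\<close> are measurable sets containing all points of
  robust loss 1, so that sample hits can be counted. They and \<open>f'\<close> depend on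
  \<open>x\<close> alone and serve every \<open>y\<close> in its neighbourhood.\<close>

lemma nbhd_robust_classifier:
  assumes x: "x \<in> prob_dist_pairs d" and N: "is_norm d N" and f: "robust_classifier d N \<epsilon> \<delta> x f"
    and \<epsilon>': "0 \<le> \<epsilon>'" and \<delta>: "0 \<le> \<delta>" and \<eta>: "0 < \<eta>"
  obtains f' A B where "A \<in> sets (borel_Rd d)" "B \<in> sets (borel_Rd d)"
    "\<And>v. v \<in> Rd d \<Longrightarrow> v \<notin> A \<Longrightarrow> robust_loss d N (\<epsilon> - \<epsilon>') f' v 0 = 0"
    "\<And>v. v \<in> Rd d \<Longrightarrow> v \<notin> B \<Longrightarrow> robust_loss d N (\<epsilon> - \<epsilon>') f' v 1 = 0"
    "\<And>y \<delta>'. y \<in> nbhd d N \<epsilon>' \<delta>' x \<Longrightarrow> measure (fst y) A \<le> \<delta> + \<delta>' + \<eta> \<and> measure (snd y) B \<le> \<delta> + \<delta>' + \<eta>"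
proof -
  have x': "fst x \<in> prob_dists d" "snd x \<in> prob_dists d"
    using x by (auto simp: prob_dist_pairs_def)
  obtain K where K: "compact K" "K \<in> sets (borel_Rd d)" "1 - \<delta> - \<eta> \<le> measure (fst x) K"
    "\<And>v. v \<in> K \<Longrightarrow> robust_loss d N \<epsilon> f v 0 = 0"
    using f by (elim robust_core[OF x'(1) \<delta> \<eta>, rotated 1]) (auto simp: robust_classifier_def)
  obtain L where L: "compact L" "L \<in> sets (borel_Rd d)" "1 - \<delta> - \<eta> \<le> measure (snd x) L"
    "\<And>v. v \<in> L \<Longrightarrow> robust_loss d N \<epsilon> f v 1 = 0"
    using f by (elim robust_core[OF x'(2) \<delta> \<eta>, rotated 1]) (auto simp: robust_classifier_def)
  have sub: "K \<subseteq> Rd d" "L \<subseteq> Rd d"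
    using sets.sets_into_space[OF K(2)] sets.sets_into_space[OF L(2)] by auto
  have far: "2 * \<epsilon> < N (\<lambda>k. u k - v k)" if "u \<in> K" "v \<in> L" for u v
    using that sub K(4) L(4) by (intro robust_cores_far_apart[OF N]) auto
  obtain r where r: "r > 0" "\<And>u v. u \<in> K \<Longrightarrow> v \<in> L \<Longrightarrow> 2 * \<epsilon> + 2 * r \<le> N (\<lambda>k. u k - v k)"
    using robust_cores_gap[OF N sub K(1) L(1) far] by blast
  \<comment> \<open>The radius is \<open>(\<epsilon>' + r) + (\<epsilon> - \<epsilon>')\<close>: a
    point of the thickened core moved by an admissible perturbation stays within it.\<close>
  define f' where "f' v = (if \<exists>u\<in>K. N (\<lambda>k. u k - v k) < \<epsilon> + r then 0 else 1 :: bit)" for v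
  let ?A = "thickening d N (\<epsilon>' + r) K" and ?B = "thickening d N (\<epsilon>' + r) L"
  have shift: "N (\<lambda>k. u k - (v k + z k)) < \<epsilon> + r"
    if "u \<in> Rd d" "v \<in> Rd d" "N (\<lambda>k. u k - v k) < \<epsilon>' + r" "z \<in> norm_ball d N (\<epsilon> - \<epsilon>')" for u v z
  proof -
    have z: "z \<in> Rd d" "N z \<le> \<epsilon> - \<epsilon>'"
      using that(4) by (auto simp: norm_ball_def)
    have "N (\<lambda>k. (u k - v k) + (- 1) * z k) \<le> N (\<lambda>k. u k - v k) + N (\<lambda>k. (- 1) * z k)"
      by (rule is_norm_triangle[OF N Rd_subspace(1)[OF that(1,2)] Rd_subspace(3)[OF z(1)]])
    moreover have "N (\<lambda>k. (- 1) * z k) = N z"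
      using is_norm_scale[OF N z(1), of "- 1"] by simp
    moreover have "(\<lambda>k. (u k - v k) + (- 1) * z k) = (\<lambda>k. u k - (v k + z k))"
      by auto
    ultimately show ?thesis
      using that(3) z(2) by simp
  qed
  show ?thesis
  proof (rule that[of "Rd d - ?A" "Rd d - ?B" f'])
    show "Rd d - ?A \<in> sets (borel_Rd d)" "Rd d - ?B \<in> sets (borel_Rd d)"
      using thickening_sets[OF N sub(1), of "\<epsilon>' + r"] thickening_sets[OF N sub(2), of "\<epsilon>' + r"]
        sets.compl_sets[where M = "borel_Rd d"] by auto
  next
    fix v assume v: "v \<in> Rd d" "v \<notin> Rd d - ?A"
    then obtain u where "u \<in> K" "N (\<lambda>k. u k - v k) < \<epsilon>' + r"
      by (auto simp: thickening_def)
    then show "robust_loss d N (\<epsilon> - \<epsilon>') f' v 0 = 0"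
      using shift[of u v] v sub by (auto simp: robust_loss_def f'_def)
  next
    fix v assume v: "v \<in> Rd d" "v \<notin> Rd d - ?B"
    then obtain w where w: "w \<in> L" "N (\<lambda>k. w k - v k) < \<epsilon>' + r"
      by (auto simp: thickening_def)
    \<comment> \<open>The perturbed point is closer than \<open>\<epsilon> + r\<close> to
      \<open>w\<close>, while \<open>u\<close> and \<open>w\<close> are at least
      \<open>2 * \<epsilon> + 2 * r\<close> apart; hence it is farther than
      \<open>\<epsilon> + r\<close> from \<open>u\<close>.\<close>
    have "\<not> N (\<lambda>k. u k - (v k + z k)) < \<epsilon> + r"
      if u: "u \<in> K" and z: "z \<in> norm_ball d N (\<epsilon> - \<epsilon>')" for u z
    proof -
      have in_Rd: "u \<in> Rd d" "w \<in> Rd d" "(\<lambda>k. v k + z k) \<in> Rd d"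
        using u w v z sub by (auto simp: norm_ball_def intro!: Rd_subspace)
      have "N (\<lambda>k. w k - (v k + z k)) < \<epsilon> + r"
        using shift[OF in_Rd(2) v(1) w(2) z] .
      then show ?thesis
        using r(2)[OF u w(1)] is_norm_triangle_diff[OF N in_Rd(1,3,2)]
          is_norm_minus_commute[OF N in_Rd(2,3)] by linarith
    qed
    then show "robust_loss d N (\<epsilon> - \<epsilon>') f' v 1 = 0"
      by (auto simp: robust_loss_def f'_def)
  next
    fix y \<delta>' assume y: "y \<in> nbhd d N \<epsilon>' \<delta>' x"
    then have y': "fst y \<in> prob_dists d" "snd y \<in> prob_dists d"
      by (auto simp: nbhd_def prob_dist_pairs_def)
    have compl: "measure P (Rd d - S) = 1 - measure P S"
      if "P \<in> prob_dists d" "S \<in> sets (borel_Rd d)" for P S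
      using that prob_space.prob_compl[of P S] sets_eq_imp_space_eq[of P "borel_Rd d"]
      by (simp add: prob_dists_def)
    show "measure (fst y) (Rd d - ?A) \<le> \<delta> + \<delta>' + \<eta> \<and> measure (snd y) (Rd d - ?B) \<le> \<delta> + \<delta>' + \<eta>"
      using nbhd_thickening[OF y x N \<epsilon>' r(1) K(2) L(2)] K(3) L(3)
        compl[OF y'(1) thickening_sets[OF N sub(1)], of "\<epsilon>' + r"]
        compl[OF y'(2) thickening_sets[OF N sub(2)], of "\<epsilon>' + r"] by linarith
  qed
qed

section \<open>The optimal cover and the learner\<close>

lemma covering_number_attained:
  assumes "covering_number d N \<D> \<epsilon>' \<delta>' \<noteq> \<infinity>"
  obtains X where "finite X" "X \<subseteq> \<D>" "\<D> \<subseteq> (\<Union>x\<in>X. nbhd d N \<epsilon>' \<delta>' x)"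
    "card X = the_enat (covering_number d N \<D> \<epsilon>' \<delta>')"
proof -
  define S where "S = (\<lambda>X. if finite X then enat (card X) else \<infinity>)
    ` {X. X \<subseteq> \<D> \<and> \<D> \<subseteq> (\<Union>x\<in>X. nbhd d N \<epsilon>' \<delta>' x)}"
  have cov: "covering_number d N \<D> \<epsilon>' \<delta>' = Inf S"
    by (simp add: covering_number_def S_def)
  have "S \<noteq> {}"
    using assms by (auto simp: cov Inf_enat_def)
  \<comment> \<open>\<open>enat\<close> is well ordered, so the infimum of a nonempty set is its
    least element; a value other than \<open>\<infinity>\<close> then forces the optimal cover to be
    finite.\<close>
  then have "Inf S \<in> S"
    using LeastI_ex[of "\<lambda>e. e \<in> S"] by (simp add: Inf_enat_def ex_in_conv)
  then obtain X where "X \<subseteq> \<D>" "\<D> \<subseteq> (\<Union>x\<in>X. nbhd d N \<epsilon>' \<delta>' x)"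
    "Inf S = (if finite X then enat (card X) else \<infinity>)"
    by (auto simp: S_def)
  then show ?thesis
    using assms by (intro that[of X]) (auto simp: cov split: if_splits)
qed

lemma learnable_if_many_samples:
  assumes N: "is_norm d N" and \<epsilon>': "\<epsilon>' \<ge> 0" and \<delta>: "\<delta> \<ge> 0" and \<delta>': "\<delta>' > 0"
    and \<D>: "\<D> \<subseteq> prob_dist_pairs d" and feasible: "robustly_feasible d N \<epsilon> \<delta> \<D>"
    and X: "finite X" "X \<subseteq> \<D>" "\<D> \<subseteq> (\<Union>x\<in>X. nbhd d N \<epsilon>' \<delta>' x)"
    and n: "real n \<ge> 320 * ((\<delta> + \<delta>') / \<delta>'\<^sup>2) * ln (real (card X))"
  shows "robustly_learnable d N (\<epsilon> - \<epsilon>') (\<delta> + 2 * \<delta>') n \<D>"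
\<comment> \<open>Any algorithm learns the empty family. Otherwise the cover is nonempty, as needed
  for a minimizer to exist.\<close>
proof (cases "\<D> = {}")
  case True
  then show ?thesis by (simp add: robustly_learnable_def)
next
  case False
  then have "X \<noteq> {}"
    using X(3) by auto
  \<comment> \<open>With \<open>\<eta> = \<delta>' / 4\<close>, this bundles what is to be chosen
    for each cover element. The choice is made before any \<open>D\<close> is fixed, so the
    algorithm may use it.\<close>
  define good where "good x g A B \<longleftrightarrow> A \<in> sets (borel_Rd d) \<and> B \<in> sets (borel_Rd d) \<and>
      (\<forall>v\<in>Rd d. v \<notin> A \<longrightarrow> robust_loss d N (\<epsilon> - \<epsilon>') g v 0 = 0) \<and>
      (\<forall>v\<in>Rd d. v \<notin> B \<longrightarrow> robust_loss d N (\<epsilon> - \<epsilon>') g v 1 = 0) \<and>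
      (\<forall>y\<in>nbhd d N \<epsilon>' \<delta>' x. measure (fst y) A \<le> \<delta> + \<delta>' + \<delta>' / 4 \<and> measure (snd y) B \<le> \<delta> + \<delta>' + \<delta>' / 4)"
    for x g A B
  have "\<exists>g A B. good x g A B" if "x \<in> X" for x
  proof -
    \<comment> \<open>The cover consists of members of \<open>\<D>\<close>, and feasibility of
      \<open>\<D>\<close> supplies their robust classifiers.\<close>
    have "x \<in> \<D>"
      using that X(2) by blast
    then have x: "x \<in> prob_dist_pairs d"
      using \<D> by blast
    obtain f where f: "robust_classifier d N \<epsilon> \<delta> x f"
      using feasible \<open>x \<in> \<D>\<close> unfolding robustly_feasible_def by blast
    have \<eta>: "0 < \<delta>' / 4"
      using \<delta>' by simp
    show ?thesis
      by (rule nbhd_robust_classifier[OF x N f \<epsilon>' \<delta> \<eta>], unfold good_def) blast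
  qed
  then obtain g A B where good: "\<And>x. x \<in> X \<Longrightarrow> good x (g x) (A x) (B x)"
    by metis
  have A: "A x \<in> sets (borel_Rd d)" and B: "B x \<in> sets (borel_Rd d)"
    and lossA: "\<And>v. v \<in> Rd d \<Longrightarrow> v \<notin> A x \<Longrightarrow> robust_loss d N (\<epsilon> - \<epsilon>') (g x) v 0 = 0"
    and lossB: "\<And>v. v \<in> Rd d \<Longrightarrow> v \<notin> B x \<Longrightarrow> robust_loss d N (\<epsilon> - \<epsilon>') (g x) v 1 = 0"
    and near: "\<And>y. y \<in> nbhd d N \<epsilon>' \<delta>' x \<Longrightarrow>
      measure (fst y) (A x) \<le> \<delta> + \<delta>' + \<delta>' / 4 \<and> measure (snd y) (B x) \<le> \<delta> + \<delta>' + \<delta>' / 4"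
    if "x \<in> X" for x
    using good[OF that] unfolding good_def by blast+
  define score where
    "score x s t = max (card {j. j < n \<and> s j \<in> A x}) (card {j. j < n \<and> t j \<in> B x})" for x s t
  \<comment> \<open>The learning rule: it depends on the sample and the cover only, not on
    \<open>D\<close>.\<close>
  define best where "best s t = arg_min_on (\<lambda>x. score x s t) X" for s t
  have best: "best s t \<in> X" "\<And>x. x \<in> X \<Longrightarrow> score (best s t) s t \<le> score x s t" for s t
    using arg_min_if_finite[OF X(1) \<open>X \<noteq> {}\<close>, of "\<lambda>x. score x s t"]
    by (auto simp: best_def not_less)
  \<comment> \<open>The two Chernoff rates are
    \<open>\<delta>'\<^sup>2 / (64 * \<delta> + 80 * \<delta>')\<close> and
    \<open>\<delta>'\<^sup>2 / (16 * \<delta> + 32 * \<delta>')\<close>; the constant 80 puts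
    \<open>c\<close> below both.\<close>
  define c where "c = \<delta>'\<^sup>2 / (80 * (\<delta> + \<delta>'))"
  have c: "c \<le> (\<delta>' / 4)\<^sup>2 / (4 * (\<delta> + \<delta>' + \<delta>' / 4))" "c \<le> (\<delta>' / 2)\<^sup>2 / (4 * (\<delta> + 2 * \<delta>'))"
    unfolding c_def power_divide divide_divide_eq_left using \<delta> \<delta>'
    by (auto intro!: divide_left_mono)
  have union_bound: "2 * real (card X) * exp (- (real n * c)) \<le> 1 / 3" if "card X \<noteq> 1"
  proof -
    define k where "k = real (card X)"
    have "card X \<ge> 2"
      using that \<open>X \<noteq> {}\<close> X(1) by (metis One_nat_def card_gt_0_iff less_Suc_eq_le not_less numeral_2_eq_2 order_antisym)
    then have k: "k \<ge> 2"
      by (simp add: k_def)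
    \<comment> \<open>As 320 / 80 = 4, the sample size gives
      \<open>exp (- (n * c)) \<le> 1 / k ^ 4\<close>, so for \<open>k \<ge> 2\<close> the failure
      probability is at most \<open>2 / k ^ 3 \<le> 1 / 4\<close>.\<close>
    have "320 * (u / w) * (w / (80 * u)) = 4" if "u > 0" "w > 0" for u w :: real
      using that by (simp add: field_simps)
    from this[of "\<delta> + \<delta>'" "\<delta>'\<^sup>2"] have "320 * ((\<delta> + \<delta>') / \<delta>'\<^sup>2) * c = 4"
      using \<delta> \<delta>' by (simp only: c_def) simp
    then have "4 * ln k = 320 * ((\<delta> + \<delta>') / \<delta>'\<^sup>2) * ln k * c"
      by (metis mult.assoc mult.commute)
    also have "\<dots> \<le> real n * c"
      using n \<delta> \<delta>' by (intro mult_right_mono) (auto simp: c_def k_def)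
    finally have "exp (- (real n * c)) \<le> exp (- (4 * ln k))"
      by simp
    also have "exp (- (4 * ln k)) = 1 / k ^ 4"
      using k exp_of_nat_mult[of 4 "ln k"] by (simp add: exp_minus inverse_eq_divide)
    finally have "2 * k * exp (- (real n * c)) \<le> 2 * k * (1 / k ^ 4)"
      using k by (intro mult_left_mono) auto
    also have "\<dots> = 2 / k ^ 3"
      using k by (simp add: field_simps eval_nat_numeral)
    also have "\<dots> \<le> 2 / 2 ^ 3"
      using k by (intro divide_left_mono power_mono) auto
    finally show ?thesis
      by (simp add: k_def)
  qed
  have "2 / 3 \<le> inner_prob (sample_space n D) {(s, t) \<in> space (sample_space n D).
      robust_classifier d N (\<epsilon> - \<epsilon>') (\<delta> + 2 * \<delta>') D (g (best s t))}" if D: "D \<in> \<D>" for D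
  proof -
    \<comment> \<open>The element covering \<open>D\<close> is the good candidate; it enters the
      analysis only, being unknown to the learner.\<close>
    obtain x0 where x0: "x0 \<in> X" "D \<in> nbhd d N \<epsilon>' \<delta>' x0"
      using D X(3) by auto
    have D': "D \<in> prob_dist_pairs d"
      using D \<D> by auto
    then have prob: "prob_space (fst D)" "prob_space (snd D)"
      and sets_D: "sets (fst D) = sets (borel_Rd d)" "sets (snd D) = sets (borel_Rd d)"
      by (simp_all add: prob_dist_pairs_def prob_dists_def mem_Times_iff)
    let ?M = "sample_space n D"
    have sets_AB: "A x \<in> sets (fst D)" "B x \<in> sets (snd D)" if "x \<in> X" for x
      using A[OF that] B[OF that] by (simp_all add: sets_D)
    have T: "0 < \<delta> + \<delta>' + \<delta>' / 4" "\<delta> + \<delta>' + \<delta>' / 4 < \<delta> + 3 / 2 * \<delta>'"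
      "\<delta> + 3 / 2 * \<delta>' < \<delta> + 2 * \<delta>'" "\<delta> + 3 / 2 * \<delta>' \<le> 3 * (\<delta> + \<delta>' + \<delta>' / 4)"
      using \<delta> \<delta>' by simp_all
    have "\<delta> + 3 / 2 * \<delta>' - (\<delta> + \<delta>' + \<delta>' / 4) = \<delta>' / 4" "\<delta> + 2 * \<delta>' - (\<delta> + 3 / 2 * \<delta>') = \<delta>' / 2"
      by simp_all
    with c have c': "c \<le> (\<delta> + 3 / 2 * \<delta>' - (\<delta> + \<delta>' + \<delta>' / 4))\<^sup>2 / (4 * (\<delta> + \<delta>' + \<delta>' / 4))"
      "c \<le> (\<delta> + 2 * \<delta>' - (\<delta> + 3 / 2 * \<delta>'))\<^sup>2 / (4 * (\<delta> + 2 * \<delta>'))"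
      by (simp_all only:)
    obtain E where E: "E \<in> sets ?M" "2 / 3 \<le> measure ?M E"
      and accurate: "\<forall>(s, t)\<in>E. \<forall>x\<in>X. (\<forall>x'\<in>X. score x s t \<le> score x' s t) \<longrightarrow>
           measure (fst D) (A x) \<le> \<delta> + 2 * \<delta>' \<and> measure (snd D) (B x) \<le> \<delta> + 2 * \<delta>'"
      by (rule empirical_minimizer[where A = A and B = B, OF prob X(1) sets_AB x0(1)
            conjunct1[OF near[OF x0]] conjunct2[OF near[OF x0]] T c' union_bound,
            folded score_def sample_space_def], assumption, assumption, assumption)
         (rule that)
    have sub: "E \<subseteq> {(s, t) \<in> space ?M. robust_classifier d N (\<epsilon> - \<epsilon>') (\<delta> + 2 * \<delta>') D (g (best s t))}"
    proof (rule subrelI)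
      fix s t assume st: "(s, t) \<in> E"
      then have "(s, t) \<in> space ?M"
        using sets.sets_into_space[OF E(1)] by auto
      moreover have "measure (fst D) (A (best s t)) \<le> \<delta> + 2 * \<delta>' \<and> measure (snd D) (B (best s t)) \<le> \<delta> + 2 * \<delta>'"
        using accurate st best by blast
      with robust_classifierI[OF D' A[OF best(1)] _ B[OF best(1)] _ lossA[OF best(1)] lossB[OF best(1)]]
      have "robust_classifier d N (\<epsilon> - \<epsilon>') (\<delta> + 2 * \<delta>') D (g (best s t))"
        by blast
      ultimately show "(s, t) \<in> {(s, t) \<in> space ?M. robust_classifier d N (\<epsilon> - \<epsilon>') (\<delta> + 2 * \<delta>') D (g (best s t))}"
        by simp
    qed
    interpret MP: prob_space "PiM {..<n} (\<lambda>_. fst D)" by (intro prob_space_PiM prob)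
    interpret MQ: prob_space "PiM {..<n} (\<lambda>_. snd D)" by (intro prob_space_PiM prob)
    interpret PQ: pair_prob_space "PiM {..<n} (\<lambda>_. fst D)" "PiM {..<n} (\<lambda>_. snd D)" ..
    \<comment> \<open>The success event need not be measurable, but the measurable set
      \<open>E\<close> inside it bounds its inner probability from below.\<close>
    have "measure ?M E \<le> inner_prob ?M {(s, t) \<in> space ?M. robust_classifier d N (\<epsilon> - \<epsilon>') (\<delta> + 2 * \<delta>') D (g (best s t))}"
      unfolding inner_prob_def using E(1) sub PQ.prob_le_1
      by (intro cSUP_upper bdd_aboveI2[where M = 1]) (auto simp: sample_space_def)
    with E(2) show ?thesis by linarith
  qed
  then show ?thesis
    unfolding robustly_learnable_def by (intro exI[of _ "\<lambda>s t. g (best s t)"] ballI)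
qed

theorem theorem3p5:
  shows "\<exists>C::real. C > 0 \<and>
    (\<forall>(d::nat) (N :: (nat \<Rightarrow> real) \<Rightarrow> real) (\<epsilon>::real) (\<epsilon>'::real) (\<delta>::real) (\<delta>'::real)
        (\<D> :: dist_pair set) (n::nat).
       is_norm d N \<longrightarrow>
       \<epsilon>' \<ge> 0 \<longrightarrow> \<epsilon> \<ge> \<epsilon>' \<longrightarrow> \<delta> \<ge> 0 \<longrightarrow> \<delta>' > 0 \<longrightarrow>
       \<D> \<subseteq> prob_dist_pairs d \<longrightarrow>
       robustly_feasible d N \<epsilon> \<delta> \<D> \<longrightarrow>
       covering_number d N \<D> \<epsilon>' \<delta>' \<noteq> \<infinity> \<longrightarrow>
       real n \<ge> C * ((\<delta> + \<delta>') / \<delta>'\<^sup>2) * ln (real (the_enat (covering_number d N \<D> \<epsilon>' \<delta>'))) \<longrightarrow>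
       robustly_learnable d N (\<epsilon> - \<epsilon>') (\<delta> + 2 * \<delta>') n \<D>)"
proof (intro exI[of _ 320] conjI allI impI)
  fix d n :: nat and N :: "(nat \<Rightarrow> real) \<Rightarrow> real" and \<epsilon> \<epsilon>' \<delta> \<delta>' :: real and \<D> :: "dist_pair set"
  assume asms: "is_norm d N" "\<epsilon>' \<ge> 0" "\<delta> \<ge> 0" "\<delta>' > 0" "\<D> \<subseteq> prob_dist_pairs d"
    "robustly_feasible d N \<epsilon> \<delta> \<D>"
    and cov: "covering_number d N \<D> \<epsilon>' \<delta>' \<noteq> \<infinity>"
    and n: "real n \<ge> 320 * ((\<delta> + \<delta>') / \<delta>'\<^sup>2) * ln (real (the_enat (covering_number d N \<D> \<epsilon>' \<delta>')))"
  obtain X where X: "finite X" "X \<subseteq> \<D>" "\<D> \<subseteq> (\<Union>x\<in>X. nbhd d N \<epsilon>' \<delta>' x)"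
    and card: "card X = the_enat (covering_number d N \<D> \<epsilon>' \<delta>')"
    using covering_number_attained[OF cov] .
  show "robustly_learnable d N (\<epsilon> - \<epsilon>') (\<delta> + 2 * \<delta>') n \<D>"
    by (rule learnable_if_many_samples[OF asms X n[folded card]])
qed simp

end
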